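(* Let $(X,d)$ be a proper CAT(0) space which is homeomorphic to $\mathbb{R}^2$. Then for all $x\in X$ and all $r>0$ the metric sphere $S(x,r)=\{y\in X : d(x,y)=r\}$ is homeomorphic to the circle $\mathbb{S}^1$. Hence the boundary $\partial X$ is homeomorphic to $\mathbb{S}^1$.
   Context: A metric space is proper if all its closed bounded subsets are compact. A geodesic space is a metric space in which any two points $x,y$ are joined by a geodesic, i.e. an isometric embedding $\xi:[0,d(x,y)]\to X$ with $\xi(0)=x$, $\xi(d(x,y))=y$. A CAT(0) space is a geodesic space $X$ such that for every geodesic triangle $T$ in $X$, every comparison triangle $\overline{T}$ in the Euclidean plane (a triangle with the same edge lengths), and all points $x,y\in T$ with corresponding points $\bar x,\bar y\in\overline{T}$, one has $d(x,y)\le d_{\mathbb{R}^2}(\bar x,\bar y)$. $\partial X$ denotes the visual boundary of the CAT(0) space $X$: the set of equivalence classes of geodesic rays, two rays being equivalent if they stay at bounded distance from each other, with the cone topology. $\mathbb{S}^1$ is the unit circle in $\mathbb{R}^2$. *)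

theory Defs
  imports "HOL-Analysis.Analysis"
begin

text \<open>The space \<open>X\<close> is a type of class \<open>metric_space\<close>; properties of the whole space are predicates
  on \<open>'a itself\<close>. Paths are total functions \<open>real \<Rightarrow> 'a\<close>, of which only the values on the stated
  parameter interval are relevant.\<close>

definition proper_space :: "'a::metric_space itself \<Rightarrow> bool" where
  "proper_space _ \<longleftrightarrow> (\<forall>S::'a set. closed S \<and> bounded S \<longrightarrow> compact S)"

definition is_geodesic :: "'a::metric_space \<Rightarrow> 'a \<Rightarrow> (real \<Rightarrow> 'a) \<Rightarrow> bool" where
  "is_geodesic x y \<xi> \<longleftrightarrow>
     (\<forall>s\<in>{0..dist x y}. \<forall>t\<in>{0..dist x y}. dist (\<xi> s) (\<xi> t) = \<bar>s - t\<bar>) \<and>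
     \<xi> 0 = x \<and> \<xi> (dist x y) = y"

definition geodesic_space :: "'a::metric_space itself \<Rightarrow> bool" where
  "geodesic_space _ \<longleftrightarrow> (\<forall>x y::'a. \<exists>\<xi>. is_geodesic x y \<xi>)"

definition geodesic_triangle ::
    "'a::metric_space \<Rightarrow> 'a \<Rightarrow> 'a \<Rightarrow> (real \<Rightarrow> 'a) \<Rightarrow> (real \<Rightarrow> 'a) \<Rightarrow> (real \<Rightarrow> 'a) \<Rightarrow> bool" where
  "geodesic_triangle p q r \<alpha> \<beta> \<gamma> \<longleftrightarrow> is_geodesic p q \<alpha> \<and> is_geodesic q r \<beta> \<and> is_geodesic r p \<gamma>"

definition comparison_triangle ::
    "'a::metric_space \<Rightarrow> 'a \<Rightarrow> 'a \<Rightarrow> real^2 \<Rightarrow> real^2 \<Rightarrow> real^2 \<Rightarrow> bool" where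
  "comparison_triangle p q r p' q' r' \<longleftrightarrow>
     dist p' q' = dist p q \<and> dist q' r' = dist q r \<and> dist r' p' = dist r p"

definition corresponding_on_side ::
    "'a::metric_space \<Rightarrow> 'a \<Rightarrow> (real \<Rightarrow> 'a) \<Rightarrow> real^2 \<Rightarrow> real^2 \<Rightarrow> 'a \<Rightarrow> real^2 \<Rightarrow> bool" where
  "corresponding_on_side p q \<xi> p' q' x x' \<longleftrightarrow>
     (\<exists>t\<in>{0..dist p q}. x = \<xi> t \<and> x' \<in> closed_segment p' q' \<and> dist p' x' = t)"

text \<open>Correspondence is a relation rather than a function, because a point of \<open>X\<close> may lie on several
  sides of a triangle and then has a comparison point on each of them.\<close>

definition corresponding_point ::
    "'a::metric_space \<Rightarrow> 'a \<Rightarrow> 'a \<Rightarrow> (real \<Rightarrow> 'a) \<Rightarrow> (real \<Rightarrow> 'a) \<Rightarrow> (real \<Rightarrow> 'a) \<Rightarrow>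
     real^2 \<Rightarrow> real^2 \<Rightarrow> real^2 \<Rightarrow> 'a \<Rightarrow> real^2 \<Rightarrow> bool" where
  "corresponding_point p q r \<alpha> \<beta> \<gamma> p' q' r' x x' \<longleftrightarrow>
     corresponding_on_side p q \<alpha> p' q' x x' \<or>
     corresponding_on_side q r \<beta> q' r' x x' \<or>
     corresponding_on_side r p \<gamma> r' p' x x'"

definition CAT0_space :: "'a::metric_space itself \<Rightarrow> bool" where
  "CAT0_space _ \<longleftrightarrow> geodesic_space TYPE('a) \<and>
     (\<forall>(p::'a) q r \<alpha> \<beta> \<gamma> p' q' r'.
        geodesic_triangle p q r \<alpha> \<beta> \<gamma> \<and> comparison_triangle p q r p' q' r' \<longrightarrow>
        (\<forall>x x' y y'.
           corresponding_point p q r \<alpha> \<beta> \<gamma> p' q' r' x x' \<and>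
           corresponding_point p q r \<alpha> \<beta> \<gamma> p' q' r' y y' \<longrightarrow>
           dist x y \<le> dist x' y'))"

definition geodesic_ray :: "(real \<Rightarrow> 'a::metric_space) \<Rightarrow> bool" where
  "geodesic_ray c \<longleftrightarrow> (\<forall>s\<ge>0. \<forall>t\<ge>0. dist (c s) (c t) = \<bar>s - t\<bar>)"

definition asymptotic :: "((real \<Rightarrow> 'a::metric_space) \<times> (real \<Rightarrow> 'a)) set" where
  "asymptotic = {(c, c'). geodesic_ray c \<and> geodesic_ray c' \<and>
     (\<exists>K. \<forall>t\<ge>0. dist (c t) (c' t) \<le> K)}"

text \<open>The values of a ray at negative parameters are arbitrary. They do not affect \<open>asymptotic\<close>, so
  passing to the quotient eliminates them.\<close>

definition visual_boundary :: "(real \<Rightarrow> 'a::metric_space) set set" where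
  "visual_boundary = {c. geodesic_ray c} // asymptotic"

text \<open>The trace on the boundary of the standard basic neighbourhood \<open>U(c, R, \<epsilon>)\<close> of the endpoint
  of \<open>c\<close>: all classes whose representative issuing from \<open>c 0\<close> is \<open>\<epsilon>\<close>-close to \<open>c\<close> at time \<open>R\<close>.\<close>

definition cone_nbhd :: "(real \<Rightarrow> 'a::metric_space) \<Rightarrow> real \<Rightarrow> real \<Rightarrow> (real \<Rightarrow> 'a) set set" where
  "cone_nbhd c R \<epsilon> = {\<eta> \<in> visual_boundary. \<exists>c'\<in>\<eta>. c' 0 = c 0 \<and> dist (c' R) (c R) < \<epsilon>}"

text \<open>The cone topology on the boundary, with base point \<open>b\<close>. In a complete CAT(0) space it does not
  depend on \<open>b\<close>, and every boundary point has exactly one representative ray issuing from \<open>b\<close>, so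
  the sets \<open>cone_nbhd c R \<epsilon>\<close> already cover the boundary; the boundary itself is listed among the
  generators only so that it is the underlying set without any hypothesis on the space.\<close>

definition cone_topology :: "'a::metric_space \<Rightarrow> (real \<Rightarrow> 'a) set topology" where
  "cone_topology b = topology_generated_by
     (insert visual_boundary {cone_nbhd c R \<epsilon> |c R \<epsilon>. geodesic_ray c \<and> c 0 = b \<and> R > 0 \<and> \<epsilon> > 0})"

lemma equiv_asymptotic: "equiv {c. geodesic_ray c} asymptotic"
proof (rule equivI)
  show "asymptotic \<subseteq> {c::real \<Rightarrow> 'a. geodesic_ray c} \<times> {c. geodesic_ray c}"
    by (auto simp: asymptotic_def)
  show "refl_on {c::real \<Rightarrow> 'a. geodesic_ray c} asymptotic"
    by (auto simp: refl_on_def asymptotic_def)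
  show "sym (asymptotic :: ((real \<Rightarrow> 'a) \<times> (real \<Rightarrow> 'a)) set)"
    by (auto simp: sym_def asymptotic_def dist_commute)
  show "trans (asymptotic :: ((real \<Rightarrow> 'a) \<times> (real \<Rightarrow> 'a)) set)"
  proof (rule transI)
    fix c d e :: "real \<Rightarrow> 'a"
    assume "(c, d) \<in> asymptotic" "(d, e) \<in> asymptotic"
    then obtain K L where rays: "geodesic_ray c" "geodesic_ray e"
      and K: "\<forall>t\<ge>0. dist (c t) (d t) \<le> K" and L: "\<forall>t\<ge>0. dist (d t) (e t) \<le> L"
      by (auto simp: asymptotic_def)
    have "dist (c t) (e t) \<le> K + L" if "t \<ge> 0" for t
      using dist_triangle[of "c t" "e t" "d t"] K L that by fastforce
    with rays show "(c, e) \<in> asymptotic" by (auto simp: asymptotic_def)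
  qed
qed

lemma topspace_cone_topology: "topspace (cone_topology b) = visual_boundary"
  by (auto simp: cone_topology_def cone_nbhd_def)

end

theory Submission
  imports Defs "HOL-Complex_Analysis.Complex_Analysis"
begin

text \<open>Identify \<open>X\<close> with the complex plane so that the base point \<open>b\<close> becomes \<open>0\<close>. A large circle
  contracts to \<open>b\<close> along geodesics, so it must sweep over every point; hence every point lies on a
  geodesic ray from \<open>b\<close>, and a loop that avoids such a ray has winding number zero about \<open>0\<close>.

  Pushing a large circle radially onto the sphere \<open>S(b, r)\<close> gives a loop of winding number one. The
  logarithm of this loop contains an arc with the same endpoints, and a shortest piece of the arc whose
  ends have the same exponential yields a Jordan curve in \<open>S(b, r)\<close> with nonzero winding number. The
  curve is the whole sphere, since it meets the ray through each point of the sphere.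

  The boundary is the inverse limit of the spheres \<open>S(b, n)\<close> under radial projection. By another
  winding number argument the projections are monotone circle maps of degree one. Lifting them to the
  real line, the threads of the inverse system are parametrized by the weighted mean
  \<open>\<Sum>\<^sub>n t\<^sub>n / 2\<^sup>n\<^sup>+\<^sup>1\<close> of their coordinates, which is strictly monotone because any two
  threads are comparable.\<close>

text \<open>The obstacle is branching: geodesics from \<open>b\<close> may share an initial piece
  and then separate, so pushing a circle inward along them, and likewise projecting a larger sphere
  to a smaller one, need not be injective. The pushed loop must therefore be replaced by a Jordan
  curve inside its image without losing all winding. This is why a logarithm is taken first: an arc
  in the logarithmic plane is injective, so two of its points with the same exponential differ by a
  nonzero multiple of \<open>2 * pi * \<i>\<close>, and every piece that closes up under
  \<open>exp\<close> winds nontrivially. Branching also prevents reading the boundary off a single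
  sphere, because the projections may collapse intervals. No single coordinate then determines a
  thread; the weighted mean sees all of them, and since the weights add up to one it commutes with
  integer shifts and descends to the circle.\<close>

section \<open>Logarithms along periodic curves and arcs\<close>

lemma lift_add_int:
  fixes f :: "real \<Rightarrow> 'b::ring_1"
  assumes "\<And>t. f (t + 1) = f t + c"
  shows "f (t + of_int n) = f t + of_int n * c"
proof (induction n rule: int_induct[of _ 0])
  case (step1 i)
  then show ?case using assms[of "t + of_int i"] by (simp add: algebra_simps)
next
  case (step2 i)
  then show ?case using assms[of "t + of_int (i - 1)"] by (simp add: algebra_simps)
qed simp

text \<open>The increment divided by \<open>2 * pi * \<i>\<close> is continuous and integer valued
  on the connected line, so it is constant.\<close>

lemma exp_lift_period:
  fixes \<nu> :: "real \<Rightarrow> complex"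
  assumes cont: "continuous_on UNIV \<nu>" and per: "\<And>t. exp (\<nu> (t + 1)) = exp (\<nu> t)"
  obtains k :: int where "\<And>t. \<nu> (t + 1) = \<nu> t + 2 * of_real pi * \<i> * of_int k"
proof -
  define w where "w = (\<lambda>t. (\<nu> (t + 1) - \<nu> t) / (2 * of_real pi * \<i>))"
  have w: "\<exists>n::int. w t = of_int n" for t
  proof -
    obtain n :: int where "\<nu> (t + 1) = \<nu> t + (of_int (2 * n) * pi) * \<i>" using per[of t] exp_eq by blast
    then have "w t = of_int n" by (simp add: w_def field_simps)
    then show ?thesis by blast
  qed
  have "w constant_on UNIV"
  proof (rule continuous_discrete_range_constant)
    show "connected (UNIV :: real set)" by simp
    have "continuous_on UNIV (\<lambda>t. \<nu> (t + 1))"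
      by (rule continuous_on_compose2[OF cont]) (auto intro!: continuous_intros)
    then show "continuous_on UNIV w" unfolding w_def by (intro continuous_intros cont) auto
    show "\<exists>e>0. \<forall>y. y \<in> UNIV \<and> w y \<noteq> w x \<longrightarrow> e \<le> cmod (w y - w x)" for x
    proof (intro exI[of _ 1] conjI allI impI)
      fix y assume "y \<in> UNIV \<and> w y \<noteq> w x"
      moreover obtain m n :: int where "w y = of_int m" "w x = of_int n" using w by metis
      ultimately have "w y - w x = of_int (m - n)" "m - n \<noteq> 0" by auto
      then show "1 \<le> cmod (w y - w x)" by (metis norm_of_int of_int_1_le_iff zero_less_abs_iff zless_iff_Suc_zadd add_le_same_cancel1 int_one_le_iff_zero_less of_int_abs)
    qed simp
  qed
  then obtain c where "\<And>t. w t = c" by (auto simp: constant_on_def)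
  moreover obtain k :: int where "w 0 = of_int k" using w by blast
  ultimately have w_eq: "w t = of_int k" for t by metis
  have "\<nu> (t + 1) = \<nu> t + 2 * of_real pi * \<i> * w t" for t
    by (simp add: w_def)
  then show ?thesis unfolding w_eq by (rule that)
qed

text \<open>A pair \<open>s < t\<close> of minimal gap with equal exponentials has no other such
  pair inside it, so the piece between them closes up to a simple loop. Its winding number is
  \<open>(g t - g s) / (2 * pi * \<i>)\<close>, nonzero because \<open>g\<close> is
  injective.\<close>

lemma simple_loop_from_exp_arc:
  fixes g :: "real \<Rightarrow> complex"
  assumes "arc g" and ends: "exp (pathfinish g) = exp (pathstart g)"
  obtains J where "simple_path J" "pathfinish J = pathstart J" "path_image J \<subseteq> exp ` path_image g"
    "winding_number J 0 \<noteq> 0"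
proof -
  have pg: "path g" and inj: "inj_on g {0..1}" using assms by (auto simp: arc_def)
  have cont: "continuous_on {0..1} g" using pg by (simp add: path_def)
  then have "uniformly_continuous_on {0..1} g" by (intro compact_uniformly_continuous) auto
  then obtain \<delta> where \<delta>: "\<delta> > 0"
    and near: "\<And>x y. x \<in> {0..1} \<Longrightarrow> y \<in> {0..1} \<Longrightarrow> dist y x < \<delta> \<Longrightarrow> dist (g y) (g x) < 1"
    unfolding uniformly_continuous_on_def by (metis zero_less_one)
  \<comment> \<open>Equal exponentials mean a difference by an integer multiple of
    \<open>2 * pi * \<i>\<close>; at distance below 1 this forces equality, against
    injectivity.\<close>
  have sep: "\<delta> \<le> t - s" if "s \<in> {0..1}" "t \<in> {0..1}" "s < t" "exp (g s) = exp (g t)" for s t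
  proof (rule ccontr)
    assume "\<not> \<delta> \<le> t - s"
    then have "dist (g t) (g s) < 1" using that by (intro near) (auto simp: dist_real_def)
    then have "\<bar>Im (g t) - Im (g s)\<bar> < 1"
      by (metis abs_Im_le_cmod dist_norm minus_complex.sel(2) order_le_less_trans)
    then have "g t = g s" by (rule exp_complex_eqI[OF less_trans]) (use that pi_gt3 in auto)
    then show False using inj that by (auto dest: inj_onD)
  qed
  \<comment> \<open>The gap bound by \<open>\<delta>\<close> replaces the non-closed condition
    \<open>fst p < snd p\<close>; by \<open>sep\<close> nothing is lost, and \<open>P\<close>
    becomes compact.\<close>
  define P where "P = {p \<in> {0..1} \<times> {0..1}. exp (g (fst p)) = exp (g (snd p)) \<and> \<delta> \<le> snd p - fst p}"
  have "closed {p \<in> {0..1} \<times> {0..1}. exp (g (fst p)) - exp (g (snd p)) = 0}"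
  proof (rule continuous_closed_preimage_constant)
    show "continuous_on ({0..1} \<times> {0..1}) (\<lambda>p. exp (g (fst p)) - exp (g (snd p)))"
      by (intro continuous_intros continuous_on_compose2[OF cont]) auto
    show "closed ({0..1::real} \<times> {0..1::real})" by (intro closed_Times) auto
  qed
  then have "closed ({p \<in> {0..1} \<times> {0..1}. exp (g (fst p)) - exp (g (snd p)) = 0} \<inter> {p. \<delta> \<le> snd p - fst p})"
    by (intro closed_Int closed_Collect_le continuous_intros)
  moreover have "bounded ({p \<in> {0..1} \<times> {0..1}. exp (g (fst p)) - exp (g (snd p)) = 0} \<inter> {p. \<delta> \<le> snd p - fst p})"
    by (rule bounded_subset[OF bounded_Times[OF bounded_closed_interval[of 0 1] bounded_closed_interval[of 0 1]]]) auto
  ultimately have "compact P"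
    unfolding P_def compact_eq_bounded_closed by (simp add: Int_def conj_assoc)
  moreover have "(0, 1) \<in> P"
    using sep[of 0 1] ends by (simp add: P_def pathfinish_def pathstart_def)
  moreover have "continuous_on P (\<lambda>p. snd p - fst p)" by (intro continuous_intros)
  ultimately obtain p where p: "p \<in> P" and min: "\<And>p'. p' \<in> P \<Longrightarrow> snd p - fst p \<le> snd p' - fst p'"
    using continuous_attains_inf[of P "\<lambda>p. snd p - fst p"] by blast
  obtain s t where st: "p = (s, t)" by (cases p)
  have s: "0 \<le> s" "s < t" "t \<le> 1" and eq: "exp (g s) = exp (g t)"
    using p \<delta> by (auto simp: P_def st)
  have only: "s' = s \<and> t' = t" if "s \<le> s'" "s' < t'" "t' \<le> t" "exp (g s') = exp (g t')" for s' t'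
  proof -
    have "(s', t') \<in> P" using that s sep[of s' t'] by (auto simp: P_def)
    from min[OF this] show ?thesis using that by (simp add: st)
  qed
  define J where "J = exp \<circ> subpath s t g"
  have psub: "path (subpath s t g)" using pg s by (intro path_subpath) auto
  show ?thesis
  proof
    have rng: "s \<le> (t - s) * x + s \<and> (t - s) * x + s \<le> t" if "x \<in> {0..1}" for x
    proof -
      have "0 \<le> (t - s) * x" "(t - s) * x \<le> (t - s)" using that s by (auto intro: mult_left_le)
      then show ?thesis by simp
    qed
    have "loop_free J"
      unfolding loop_free_def
    proof (intro ballI impI)
      have *: "x = y \<or> x = 0 \<and> y = 1" if "x \<in> {0..1}" "y \<in> {0..1}" "J x = J y" "x \<le> y" for x y
      proof (cases "x = y")
        case False
        then have "(t - s) * x + s = s \<and> (t - s) * y + s = t"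
          using that s rng[OF that(1)] rng[OF that(2)] by (intro only) (auto simp: J_def subpath_def)
        then have "(t - s) * x = 0" "(t - s) * (1 - y) = 0" by (auto simp: algebra_simps)
        then show ?thesis using s by auto
      qed auto
      fix x y :: real assume "x \<in> {0..1}" "y \<in> {0..1}" "J x = J y"
      then show "x = y \<or> x = 0 \<and> y = 1 \<or> x = 1 \<and> y = 0"
        using *[of x y] *[of y x] by (cases "x \<le> y") auto
    qed
    moreover have "path J" unfolding J_def by (intro path_continuous_image[OF psub] continuous_intros)
    ultimately show "simple_path J" by (simp add: simple_path_def)
    show "pathfinish J = pathstart J" using eq by (simp add: J_def pathfinish_def pathstart_def subpath_def)
    have "path_image (subpath s t g) \<subseteq> path_image g" using s by (intro path_image_subpath_subset) auto
    then show "path_image J \<subseteq> exp ` path_image g" unfolding J_def by (auto simp: path_image_compose)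
    have "winding_number J 0 = (g t - g s) / (2 * of_real pi * \<i>)"
      unfolding J_def using winding_number_compose_exp[OF psub] by simp
    moreover have "g t \<noteq> g s" using inj s by (auto dest: inj_onD)
    ultimately show "winding_number J 0 \<noteq> 0" by simp
  qed
qed

subsection \<open>Geodesics in CAT(0) spaces\<close>

text \<open>Put \<open>x\<close> at the origin and \<open>u\<close> on the first axis. The law of
  cosines dictates the first coordinate \<open>a\<close> of the third vertex, and the triangle
  inequality bounds it by \<open>q\<close>, so the second coordinate is a real square root.\<close>

lemma comparison_triangle_exists:
  fixes x u v :: "'a::metric_space"
  assumes "x \<noteq> u"
  obtains q' r' :: "real^2" where "comparison_triangle x u v 0 q' r'"
proof -
  define p q d where "p = dist x u" and "q = dist x v" and "d = dist u v"
  have p: "p > 0" using assms by (simp add: p_def)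
  have tri: "d \<le> p + q" "p \<le> d + q" "q \<le> p + d"
    unfolding p_def q_def d_def by (metis dist_commute dist_triangle)+
  have nn: "q \<ge> 0" "d \<ge> 0" by (auto simp: q_def d_def)
  define a where "a = (p\<^sup>2 + q\<^sup>2 - d\<^sup>2) / (2 * p)"
  have "\<bar>p\<^sup>2 + q\<^sup>2 - d\<^sup>2\<bar> \<le> 2 * p * q"
  proof -
    have "(p - q)\<^sup>2 \<le> d\<^sup>2" using tri by (simp add: abs_le_square_iff[symmetric])
    moreover have "d\<^sup>2 \<le> (p + q)\<^sup>2" using tri nn by (intro power_mono) auto
    ultimately show ?thesis by (auto simp: power2_eq_square algebra_simps abs_if)
  qed
  then have "\<bar>a\<bar> \<le> q" using p by (simp add: a_def field_simps)
  then have a: "a\<^sup>2 \<le> q\<^sup>2" using nn abs_le_square_iff by fastforce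
  define q' r' :: "real^2" where "q' = vector [p, 0]" and "r' = vector [a, sqrt (q\<^sup>2 - a\<^sup>2)]"
  have 1: "dist 0 q' = p" using p by (simp add: q'_def dist_norm norm_vec_def L2_set_def sum_2)
  have 2: "dist r' 0 = q" using a nn by (simp add: r'_def dist_norm norm_vec_def L2_set_def sum_2)
  have "(p - a)\<^sup>2 + (q\<^sup>2 - a\<^sup>2) = d\<^sup>2"
    using p by (simp add: a_def power2_eq_square field_simps)
  then have 3: "dist q' r' = d"
    using a nn by (simp add: q'_def r'_def dist_norm norm_vec_def L2_set_def sum_2)
  show ?thesis
    by (rule that[of q' r']) (use 1 2 3 in \<open>auto simp: comparison_triangle_def p_def q_def d_def dist_commute\<close>)
qed

lemma is_geodesic_reverse:
  assumes "is_geodesic x y \<xi>"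
  shows "is_geodesic y x (\<lambda>t. \<xi> (dist x y - t))"
  using assms by (auto simp: is_geodesic_def dist_commute abs_minus_commute)

lemma is_geodesic_initial:
  assumes "is_geodesic x y \<xi>" "0 \<le> t" "t \<le> dist x y"
  shows "dist x (\<xi> t) = t" "is_geodesic x (\<xi> t) \<xi>"
proof -
  show *: "dist x (\<xi> t) = t"
    using assms unfolding is_geodesic_def
    by (metis abs_of_nonneg atLeastAtMost_iff diff_zero dist_commute order_refl order_trans)
  show "is_geodesic x (\<xi> t) \<xi>"
    using assms unfolding is_geodesic_def * by auto
qed

text \<open>The choice is immaterial on \<open>{0..dist x y}\<close> once the space is CAT(0), by
  \<open>geodesic_unique\<close>; outside that interval the values are unspecified, which is why
  later statements bound the parameter.\<close>

definition geo :: "'a::metric_space \<Rightarrow> 'a \<Rightarrow> real \<Rightarrow> 'a" where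
  "geo x y = (SOME \<xi>. is_geodesic x y \<xi>)"

locale cat0 =
  fixes b :: "'a::metric_space"
  assumes cat0: "CAT0_space TYPE('a)"
begin

lemma is_geodesic_geo: "is_geodesic (x::'a) y (geo x y)"
proof -
  have "\<exists>\<xi>. is_geodesic x y \<xi>" using cat0 by (simp add: CAT0_space_def geodesic_space_def)
  then show ?thesis unfolding geo_def by (rule someI_ex)
qed

text \<open>With the apex at the origin the comparison points are multiples of \<open>q'\<close> and
  \<open>r'\<close>; expanding their squared distance and eliminating the inner product by the law
  of cosines gives the bound. Proportional parameters yield contraction, equal parameters the
  convergence in \<open>asymptotic_ray_from_base\<close>.\<close>

lemma cat0_inequality:
  fixes x u v :: 'a
  assumes \<xi>: "is_geodesic x u \<xi>" and \<eta>: "is_geodesic x v \<eta>" and "x \<noteq> u" "x \<noteq> v"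
    and s: "0 \<le> s" "s \<le> dist x u" and t: "0 \<le> t" "t \<le> dist x v"
  shows "(dist (\<xi> s) (\<eta> t))\<^sup>2 \<le>
    s\<^sup>2 + t\<^sup>2 - s * t / (dist x u * dist x v) * ((dist x u)\<^sup>2 + (dist x v)\<^sup>2 - (dist u v)\<^sup>2)"
proof -
  define p q d where "p = dist x u" and "q = dist x v" and "d = dist u v"
  have pos: "p > 0" "q > 0" using assms by (auto simp: p_def q_def)
  obtain q' r' :: "real^2" where ct: "comparison_triangle x u v 0 q' r'"
    using comparison_triangle_exists[OF \<open>x \<noteq> u\<close>] .
  then have n: "norm q' = p" "norm r' = q" "norm (q' - r') = d"
    by (auto simp: comparison_triangle_def p_def q_def d_def dist_norm dist_commute norm_minus_commute)
  define \<gamma> where "\<gamma> = (\<lambda>t. \<eta> (dist x v - t))"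
  have gt: "geodesic_triangle x u v \<xi> (geo u v) \<gamma>"
    using \<xi> is_geodesic_geo is_geodesic_reverse[OF \<eta>] by (auto simp: geodesic_triangle_def \<gamma>_def)
  define x' y' where "x' = (s / p) *\<^sub>R q'" and "y' = (t / q) *\<^sub>R r'"
  have "corresponding_on_side x u \<xi> 0 q' (\<xi> s) x'"
    unfolding corresponding_on_side_def using s pos n
    by (intro bexI[of _ s]) (auto simp: x'_def in_segment p_def intro!: exI[of _ "s / p"])
  \<comment> \<open>The third side runs from \<open>v\<close> back to \<open>x\<close>, so
    \<open>\<eta> t\<close> sits at parameter \<open>q - t\<close>.\<close>
  moreover have "corresponding_on_side v x \<gamma> r' 0 (\<eta> t) y'"
  proof -
    have "r' - y' = (1 - t / q) *\<^sub>R r'" by (simp add: y'_def algebra_simps)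
    then have "norm (r' - y') = \<bar>1 - t / q\<bar> * q" using n by simp
    also have "\<dots> = q - t" using pos t by (simp add: q_def abs_if field_simps)
    finally have "dist r' y' = q - t" by (simp add: dist_norm)
    moreover have "y' \<in> closed_segment r' 0"
      using t pos by (auto simp: y'_def in_segment q_def intro!: exI[of _ "1 - t / q"])
    ultimately show ?thesis
      unfolding corresponding_on_side_def using t
      by (intro bexI[of _ "q - t"]) (auto simp: \<gamma>_def q_def dist_commute)
  qed
  ultimately have "dist (\<xi> s) (\<eta> t) \<le> dist x' y'"
    using cat0 gt ct unfolding CAT0_space_def corresponding_point_def by blast
  then have "(dist (\<xi> s) (\<eta> t))\<^sup>2 \<le> (dist x' y')\<^sup>2" by (intro power_mono) auto
  also have "\<dots> = x' \<bullet> x' + y' \<bullet> y' - 2 * (x' \<bullet> y')"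
    by (simp add: dist_norm power2_norm_eq_inner inner_diff inner_commute)
  also have "\<dots> = s\<^sup>2 + t\<^sup>2 - 2 * (s * t / (p * q) * (q' \<bullet> r'))"
  proof -
    have "q' \<bullet> q' = p\<^sup>2" "r' \<bullet> r' = q\<^sup>2" using n by (simp_all add: dot_square_norm)
    then show ?thesis using pos by (simp add: x'_def y'_def power2_eq_square field_simps)
  qed
  also have "2 * (q' \<bullet> r') = p\<^sup>2 + q\<^sup>2 - d\<^sup>2"
    using n by (simp add: dot_norm_neg)
  then have "2 * (s * t / (p * q) * (q' \<bullet> r')) = s * t / (p * q) * (p\<^sup>2 + q\<^sup>2 - d\<^sup>2)"
    by (metis mult.left_commute)
  finally show ?thesis by (simp add: p_def q_def d_def)
qed

text \<open>At equal proportion \<open>l\<close> on both sides the bound of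
  \<open>cat0_inequality\<close> collapses to the square of \<open>l * dist u v\<close>. Degenerate
  sides are split off because that bound divides by the side lengths.\<close>

lemma geodesic_contraction:
  fixes x u v :: 'a
  assumes \<xi>: "is_geodesic x u \<xi>" and \<eta>: "is_geodesic x v \<eta>" and l: "0 \<le> l" "l \<le> 1"
  shows "dist (\<xi> (l * dist x u)) (\<eta> (l * dist x v)) \<le> l * dist u v"
proof -
  have le: "l * dist x u \<le> dist x u" "l * dist x v \<le> dist x v"
    using l by (auto intro: mult_left_le_one_le)
  consider "x = u" | "x = v" | "x \<noteq> u" "x \<noteq> v" by blast
  then show ?thesis
  proof cases
    case 1
    then show ?thesis using is_geodesic_initial(1)[OF \<eta>, of "l * dist x v"] le l \<xi>
      by (simp add: is_geodesic_def)
  next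
    case 2
    then show ?thesis using is_geodesic_initial(1)[OF \<xi>, of "l * dist x u"] le l \<eta>
      by (simp add: is_geodesic_def dist_commute)
  next
    case 3
    then have "l * dist x u * (l * dist x v) / (dist x u * dist x v) = l\<^sup>2"
      by (simp add: power2_eq_square)
    then have "(dist (\<xi> (l * dist x u)) (\<eta> (l * dist x v)))\<^sup>2 \<le> (l * dist x u)\<^sup>2 + (l * dist x v)\<^sup>2
        - l\<^sup>2 * ((dist x u)\<^sup>2 + (dist x v)\<^sup>2 - (dist u v)\<^sup>2)"
      using cat0_inequality[OF \<xi> \<eta> 3, of "l * dist x u" "l * dist x v"] le l by simp
    also have "\<dots> = (l * dist u v)\<^sup>2" by (simp add: power_mult_distrib algebra_simps)
    finally have "(dist (\<xi> (l * dist x u)) (\<eta> (l * dist x v)))\<^sup>2 \<le> (l * dist u v)\<^sup>2" .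
    then show ?thesis by (rule power2_le_imp_le) (simp add: l)
  qed
qed

lemma geodesic_unique:
  fixes x u :: 'a
  assumes "is_geodesic x u \<xi>" "is_geodesic x u \<eta>" "0 \<le> s" "s \<le> dist x u"
  shows "\<xi> s = \<eta> s"
proof (cases "x = u")
  case True
  then show ?thesis using assms by (simp add: is_geodesic_def)
next
  case False
  then show ?thesis using geodesic_contraction[OF assms(1,2), of "s / dist x u"] assms(3,4) by simp
qed

lemma geo_eqI:
  assumes "is_geodesic (x::'a) u \<xi>" "0 \<le> s" "s \<le> dist x u"
  shows "geo x u s = \<xi> s"
  by (rule geodesic_unique[OF is_geodesic_geo assms])

lemma dist_geo: "0 \<le> t \<Longrightarrow> t \<le> dist (x::'a) z \<Longrightarrow> dist x (geo x z t) = t"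
  by (rule is_geodesic_initial(1)[OF is_geodesic_geo])

lemma geo_geo:
  assumes "0 \<le> s" "s \<le> t" "t \<le> dist (x::'a) z"
  shows "geo x (geo x z t) s = geo x z s"
  using assms is_geodesic_initial[OF is_geodesic_geo[of x z], of t]
  by (intro geo_eqI[where \<xi> = "geo x z"]) simp_all

lemma geo_end [simp]: "geo (x::'a) z (dist x z) = z" and geo_start [simp]: "geo (x::'a) z 0 = x"
  using is_geodesic_geo[of x z] by (auto simp: is_geodesic_def)

lemma dist_geo_geo:
  "0 \<le> s \<Longrightarrow> s \<le> dist (x::'a) z \<Longrightarrow> 0 \<le> t \<Longrightarrow> t \<le> dist x z \<Longrightarrow> dist (geo x z s) (geo x z t) = \<bar>s - t\<bar>"
  using is_geodesic_geo[of x z] by (auto simp: is_geodesic_def)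

text \<open>The change is split in two: moving the endpoint at fixed proportion, controlled by
  contraction, and then changing the proportion along one geodesic. Joint continuity is what the
  homotopies below require.\<close>

lemma continuous_on_geodesic_homotopy:
  "continuous_on (UNIV \<times> {0..1}) (\<lambda>(z::'a, l). geo x z (l * dist x z))"
proof -
  let ?G = "\<lambda>(z, l). geo x z (l * dist x z)"
  have bound: "dist (?G (w, m)) (?G (z, l)) \<le> dist w z + \<bar>m - l\<bar> * dist x z"
    if "l \<in> {0..1}" "m \<in> {0..1}" for z w :: 'a and l m
  proof -
    have "dist (geo x w (m * dist x w)) (geo x z (m * dist x z)) \<le> m * dist w z"
      using that by (intro geodesic_contraction[OF is_geodesic_geo is_geodesic_geo]) auto
    also have "\<dots> \<le> dist w z" using that by (auto intro: mult_left_le_one_le)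
    finally have 1: "dist (geo x w (m * dist x w)) (geo x z (m * dist x z)) \<le> dist w z" .
    have "dist (geo x z (m * dist x z)) (geo x z (l * dist x z)) = \<bar>m * dist x z - l * dist x z\<bar>"
      using that by (intro dist_geo_geo) (auto intro: mult_left_le_one_le)
    also have "\<dots> = \<bar>m - l\<bar> * dist x z" by (simp add: abs_mult flip: left_diff_distrib)
    finally show ?thesis using 1 dist_triangle[of "?G (w, m)" "?G (z, l)" "geo x z (m * dist x z)"] by simp
  qed
  show ?thesis
    unfolding continuous_on_def
  proof
    fix a :: "'a \<times> real" assume a: "a \<in> UNIV \<times> {0..1}"
    have "((\<lambda>y. dist (?G y) (?G a)) \<longlongrightarrow> 0) (at a within UNIV \<times> {0..1})"
    proof (rule Lim_null_comparison)
      show "\<forall>\<^sub>F y in at a within UNIV \<times> {0..1}.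
          norm (dist (?G y) (?G a)) \<le> dist (fst y) (fst a) + \<bar>snd y - snd a\<bar> * dist x (fst a)"
        unfolding eventually_at_filter using a bound
        by (intro always_eventually) (auto simp: case_prod_unfold)
      have "((\<lambda>y. dist (fst y) (fst a) + \<bar>snd y - snd a\<bar> * dist x (fst a)) \<longlongrightarrow>
          dist (fst a) (fst a) + \<bar>snd a - snd a\<bar> * dist x (fst a)) (at a within UNIV \<times> {0..1})"
        by (intro tendsto_intros)
      then show "((\<lambda>y. dist (fst y) (fst a) + \<bar>snd y - snd a\<bar> * dist x (fst a)) \<longlongrightarrow> 0)
          (at a within UNIV \<times> {0..1})" by simp
    qed
    then show "(?G \<longlongrightarrow> ?G a) (at a within UNIV \<times> {0..1})" by (rule tendsto_dist_iff[THEN iffD2])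
  qed
qed

lemma continuous_on_geo_param:
  fixes f :: "'c::topological_space \<Rightarrow> 'a"
  assumes "continuous_on A f" "continuous_on A l" "\<And>a. a \<in> A \<Longrightarrow> 0 \<le> l a \<and> l a \<le> 1"
  shows "continuous_on A (\<lambda>a. geo x (f a) (l a * dist x (f a)))"
proof -
  have "continuous_on A (\<lambda>a. (f a, l a))" "(\<lambda>a. (f a, l a)) ` A \<subseteq> UNIV \<times> {0..1}"
    using assms by (auto intro!: continuous_intros)
  from continuous_on_compose2[OF continuous_on_geodesic_homotopy[of x] this] show ?thesis by simp
qed

text \<open>Radius \<open>r\<close> is reached at proportion \<open>r / dist x z\<close>, which is
  at most 1 outside the open ball.\<close>

lemma continuous_on_geo_radius:
  assumes "r > 0"
  shows "continuous_on {z::'a. r \<le> dist x z} (\<lambda>z. geo x z r)"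
proof -
  have "continuous_on {z::'a. r \<le> dist x z} (\<lambda>z. geo x z (r / dist x z * dist x z))"
    using assms by (intro continuous_on_geo_param[where f = "\<lambda>z. z"] continuous_intros) (auto simp: divide_le_eq_1)
  moreover have "r / dist x z * dist x z = r" if "r \<le> dist x z" for z :: 'a
    using that assms by auto
  ultimately show ?thesis
    by (subst (asm) continuous_on_cong[OF refl, of _ _ "\<lambda>z. geo x z r"]) auto
qed

lemma ray_is_geodesic:
  fixes c :: "real \<Rightarrow> 'a"
  assumes "geodesic_ray c" "0 \<le> t"
  shows "dist (c 0) (c t) = t" "is_geodesic (c 0) (c t) c"
proof -
  show *: "dist (c 0) (c t) = t" using assms by (simp add: geodesic_ray_def)
  show "is_geodesic (c 0) (c t) c" using assms unfolding is_geodesic_def * by (auto simp: geodesic_ray_def)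
qed

lemma geo_ray:
  fixes c :: "real \<Rightarrow> 'a"
  assumes "geodesic_ray c" "0 \<le> s" "s \<le> t"
  shows "geo (c 0) (c t) s = c s"
  using ray_is_geodesic[OF assms(1), of t] assms by (intro geo_eqI[where \<xi> = c]) simp_all

text \<open>By contraction, a gap \<open>D\<close> at time \<open>t\<close> forces a gap of at least
  \<open>D * T / t\<close> at time \<open>T\<close>, which outgrows any bound
  \<open>K\<close>.\<close>

lemma asymptotic_rays_eq:
  fixes c c' :: "real \<Rightarrow> 'a"
  assumes "(c, c') \<in> asymptotic" "c 0 = c' 0" "0 \<le> t"
  shows "c t = c' t"
proof (rule ccontr)
  assume ne: "c t \<noteq> c' t"
  have rays: "geodesic_ray c" "geodesic_ray c'" using assms by (auto simp: asymptotic_def)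
  obtain K where K: "\<And>t. t \<ge> 0 \<Longrightarrow> dist (c t) (c' t) \<le> K" using assms by (auto simp: asymptotic_def)
  have t: "t > 0" using ne assms by (cases "t = 0") auto
  define D where "D = dist (c t) (c' t)"
  have D: "D > 0" using ne by (simp add: D_def)
  \<comment> \<open>Chosen so that \<open>D * T / t = K + D\<close>, already larger than
    \<open>K\<close>.\<close>
  define T where "T = t * (K / D + 1)"
  have "K \<ge> 0" using K[of 0] assms by simp
  then have T: "T \<ge> t" using t D by (simp add: T_def algebra_simps)
  have "D \<le> t / T * dist (c T) (c' T)"
    using geodesic_contraction[OF ray_is_geodesic(2)[OF rays(1), of T], of "c' T" c' "t / T"]
      ray_is_geodesic[OF rays(2), of T] ray_is_geodesic(1)[OF rays(1), of T] T t assms(2)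
    by (simp add: D_def)
  also have "\<dots> \<le> t / T * K" using K[of T] T t by (intro mult_left_mono) auto
  finally have "D * T \<le> t * K" using T t by (simp add: field_simps)
  then show False using mult_pos_pos[OF D t] D by (simp add: T_def algebra_simps)
qed

end

subsection \<open>CAT(0) planes\<close>

locale cat0_plane = cat0 b for b :: "'a::metric_space" +
  fixes h :: "'a \<Rightarrow> complex" and H :: "complex \<Rightarrow> 'a"
  assumes proper: "proper_space TYPE('a)"
    and homeo: "homeomorphism UNIV UNIV h H"
    and h_base: "h b = 0"
begin

lemma H_h [simp]: "H (h x) = x" and h_H [simp]: "h (H z) = z"
  using homeo by (auto simp: homeomorphism_def)

lemma h_eq_iff [simp]: "h x = h y \<longleftrightarrow> x = y"
  by (metis H_h)

lemma h_eq_0_iff [simp]: "h x = 0 \<longleftrightarrow> x = b"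
  by (metis h_base h_eq_iff)

lemma continuous_on_h: "continuous_on A h" and continuous_on_H: "continuous_on B H"
  using homeo continuous_on_subset unfolding homeomorphism_def by blast+

lemma compact_cball_X: "compact (cball (x::'a) R)"
  using proper bounded_cball closed_cball by (auto simp: proper_space_def)

lemma big_circle:
  obtains \<rho> where "\<rho> > 0" "\<And>y. dist b y \<le> R \<Longrightarrow> norm (h y) < \<rho>"
proof -
  have "compact (h ` cball b R)" by (intro compact_continuous_image continuous_on_h compact_cball_X)
  then obtain \<rho> where \<rho>: "\<rho> > 0" "\<And>z. z \<in> h ` cball b R \<Longrightarrow> norm z \<le> \<rho>"
    using compact_imp_bounded bounded_pos by metis
  then show ?thesis by (intro that[of "\<rho> + 1"]) (force simp: image_iff)+
qed

text \<open>Common form of the three contractions below: \<open>m\<close> is the proportion of the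
  geodesic from \<open>b\<close> that is kept, equal at both ends of the loop so that each stage
  closes up.\<close>

lemma geodesic_loop_homotopy:
  fixes m :: "real \<times> real \<Rightarrow> real"
  assumes "path \<gamma>" "pathfinish \<gamma> = pathstart \<gamma>"
    and m: "continuous_on ({0..1} \<times> {0..1}) m"
      "\<And>s x. s \<in> {0..1} \<Longrightarrow> x \<in> {0..1} \<Longrightarrow> 0 \<le> m (s, x) \<and> m (s, x) \<le> 1"
      "\<And>s. s \<in> {0..1} \<Longrightarrow> m (s, 0) = m (s, 1)"
    and S: "\<And>s x. s \<in> {0..1} \<Longrightarrow> x \<in> {0..1} \<Longrightarrow> h (geo b (H (\<gamma> x)) (m (s, x) * dist b (H (\<gamma> x)))) \<in> S"
  shows "homotopic_loops S (\<lambda>x. h (geo b (H (\<gamma> x)) (m (0, x) * dist b (H (\<gamma> x)))))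
    (\<lambda>x. h (geo b (H (\<gamma> x)) (m (1, x) * dist b (H (\<gamma> x)))))"
proof -
  let ?K = "\<lambda>p. h (geo b (H (\<gamma> (snd p))) (m p * dist b (H (\<gamma> (snd p)))))"
  have "continuous_on ({0..1} \<times> {0..1}) (\<lambda>p. \<gamma> (snd p))"
    using assms(1) unfolding path_def
    by (rule continuous_on_compose2) (auto intro!: continuous_intros)
  then have "continuous_on ({0..1} \<times> {0..1}) (\<lambda>p. H (\<gamma> (snd p)))"
    by (rule continuous_on_compose2[OF continuous_on_H]) auto
  then have "continuous_on ({0..1} \<times> {0..1}) (\<lambda>p. geo b (H (\<gamma> (snd p))) (m p * dist b (H (\<gamma> (snd p)))))"
    using m by (intro continuous_on_geo_param[where f = "\<lambda>p. H (\<gamma> (snd p))"]) auto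
  then have "continuous_on ({0..1} \<times> {0..1}) ?K"
    by (rule continuous_on_compose2[OF continuous_on_h]) auto
  moreover have "\<gamma> 1 = \<gamma> 0" using assms(2) by (simp add: pathfinish_def pathstart_def)
  ultimately show ?thesis
    unfolding homotopic_loops using m S
    by (intro exI[of _ ?K]) (auto simp: pathfinish_def pathstart_def)
qed

text \<open>If no geodesic from \<open>b\<close> to a point far away passed through \<open>y\<close>, then a large circle would
  contract along geodesics to \<open>b\<close> within the complement of \<open>y\<close>.\<close>

lemma geodesic_extends:
  assumes "y \<noteq> b"
  obtains z where "R \<le> dist b z" "dist b y \<le> dist b z" "geo b z (dist b y) = y"
proof (rule ccontr)
  assume "\<not> thesis"
  with that have no: "\<And>z. R \<le> dist b z \<Longrightarrow> dist b y \<le> dist b z \<Longrightarrow> geo b z (dist b y) \<noteq> y" by blast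
  \<comment> \<open>The maximum puts the circle beyond distance \<open>R\<close>, so that
    \<open>no\<close> applies to its points, and beyond \<open>y\<close>, so that it winds once
    around \<open>h y\<close>.\<close>
  obtain \<rho> where \<rho>: "\<rho> > 0" "\<And>x. dist b x \<le> max R (dist b y) \<Longrightarrow> norm (h x) < \<rho>"
    using big_circle by blast
  let ?\<gamma> = "circlepath 0 \<rho>" and ?m = "\<lambda>p::real \<times> real. 1 - fst p"
  have far: "dist b (H (?\<gamma> x)) > max R (dist b y)" if "x \<in> {0..1}" for x
  proof -
    have "?\<gamma> x \<in> path_image ?\<gamma>" using that by (auto simp: path_image_def)
    then have "norm (h (H (?\<gamma> x))) = \<rho>" using \<rho> by simp
    then show ?thesis using \<rho>(2)[of "H (?\<gamma> x)"] by force
  qed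
  have "homotopic_loops (- {h y}) (\<lambda>x. h (geo b (H (?\<gamma> x)) (?m (0, x) * dist b (H (?\<gamma> x)))))
    (\<lambda>x. h (geo b (H (?\<gamma> x)) (?m (1, x) * dist b (H (?\<gamma> x)))))"
  proof (rule geodesic_loop_homotopy)
    fix s x :: real assume sx: "s \<in> {0..1}" "x \<in> {0..1}"
    let ?z = "H (?\<gamma> x)" and ?l = "(1 - s) * dist b (H (?\<gamma> x))"
    have "0 \<le> ?l" "?l \<le> dist b ?z" using sx by (auto intro: mult_left_le_one_le)
    then have "dist b (geo b ?z ?l) = ?l" by (rule dist_geo)
    \<comment> \<open>A geodesic from \<open>b\<close> can meet \<open>y\<close> only at time
      \<open>dist b y\<close>, and that is the time excluded by \<open>no\<close>.\<close>
    then have "geo b ?z ?l \<noteq> y" using no[of ?z] far[OF sx(2)] by force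
    then show "h (geo b (H (?\<gamma> x)) (?m (s, x) * dist b (H (?\<gamma> x)))) \<in> - {h y}" by simp
  qed (auto intro!: continuous_intros)
  then have "homotopic_loops (- {h y}) ?\<gamma> (\<lambda>x. 0)" by (simp add: h_base)
  then have "winding_number ?\<gamma> (h y) = winding_number (\<lambda>x. 0) (h y)" by (rule winding_number_homotopic_loops)
  moreover have "winding_number ?\<gamma> (h y) = 1" using \<rho>(2)[of y] by (intro winding_number_circlepath) simp
  moreover have "winding_number (\<lambda>x. 0) (h y) = 0" 
    using assms by (intro winding_number_constI[of 0]) (auto simp: eq_commute[of 0])
  ultimately show False by simp
qed

text \<open>Each geodesic extends the previous one, so at time \<open>t\<close> all indices with
  \<open>t \<le> dist b (z n)\<close> agree; by \<open>ge\<close> the ceiling of \<open>t\<close> is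
  such an index.\<close>

lemma ray_from_chain:
  assumes ge: "\<And>n. real n \<le> dist b (z n)" and step: "\<And>n. dist b (z n) \<le> dist b (z (Suc n))"
    and geo_step: "\<And>n. geo b (z (Suc n)) (dist b (z n)) = z n"
  obtains c where "geodesic_ray c" "c 0 = b" "\<And>n t. 0 \<le> t \<Longrightarrow> t \<le> dist b (z n) \<Longrightarrow> c t = geo b (z n) t"
proof -
  have mono: "dist b (z n) \<le> dist b (z m)" if "n \<le> m" for n m
    using that by (rule lift_Suc_mono_le[of "\<lambda>n. dist b (z n)", OF step])
  have geo_z: "geo b (z m) t = geo b (z n) t" if "n \<le> m" "0 \<le> t" "t \<le> dist b (z n)" for n m t
    using that(1)
  proof (induction m rule: dec_induct)
    case (step k)
    have "geo b (z k) t = geo b (z (Suc k)) t"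
      using geo_geo[of t "dist b (z k)" b "z (Suc k)"] that mono[of n k] mono[of k "Suc k"] step
      by (simp add: geo_step)
    then show ?case using step by simp
  qed simp
  define c where "c = (\<lambda>t. geo b (z (nat \<lceil>t\<rceil>)) t)"
  have c: "c t = geo b (z n) t" if "0 \<le> t" "t \<le> dist b (z n)" for t n
  proof -
    have "t \<le> dist b (z (nat \<lceil>t\<rceil>))" using ge[of "nat \<lceil>t\<rceil>"] that by linarith
    then show ?thesis
      using geo_z[of "nat \<lceil>t\<rceil>" n t] geo_z[of n "nat \<lceil>t\<rceil>" t] that linorder_linear[of n "nat \<lceil>t\<rceil>"]
      unfolding c_def by metis
  qed
  show ?thesis
  proof (rule that[OF _ _ c])
    show "geodesic_ray c"
      unfolding geodesic_ray_def
    proof (intro allI impI)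
      fix s t :: real assume st: "0 \<le> s" "0 \<le> t"
      define m where "m = nat \<lceil>max s t\<rceil>"
      have m: "s \<le> dist b (z m)" "t \<le> dist b (z m)" using ge[of m] unfolding m_def by linarith+
      then have "dist (c s) (c t) = dist (geo b (z m) s) (geo b (z m) t)" using st c by simp
      also have "\<dots> = \<bar>s - t\<bar>" using st m by (intro dist_geo_geo) auto
      finally show "dist (c s) (c t) = \<bar>s - t\<bar>" .
    qed
    show "c 0 = b" by (simp add: c_def)
  qed
qed

text \<open>Each extension gains at least 1. Without a fixed gain the lengths could converge and the
  union of the geodesics would be a finite segment.\<close>

lemma ray_through:
  assumes "y \<noteq> b"
  obtains c where "geodesic_ray c" "c 0 = b" "c (dist b y) = y"
proof -
  have "\<exists>z. \<forall>n. (z n \<noteq> b \<and> (n = 0 \<longrightarrow> z n = y)) \<and>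
    (dist b (z n) + 1 \<le> dist b (z (Suc n)) \<and> geo b (z (Suc n)) (dist b (z n)) = z n)"
  proof (rule dependent_nat_choice)
    show "\<exists>x. x \<noteq> b \<and> (0 = (0::nat) \<longrightarrow> x = y)" using assms by auto
    fix x n assume "x \<noteq> b \<and> (n = (0::nat) \<longrightarrow> x = y)"
    then obtain w where w: "dist b x + 1 \<le> dist b w" "geo b w (dist b x) = x"
      using geodesic_extends[of x "dist b x + 1"] by metis
    then have "w \<noteq> b" using zero_le_dist[of b x] by (intro notI) simp
    with w show "\<exists>w. (w \<noteq> b \<and> (Suc n = 0 \<longrightarrow> w = y)) \<and> dist b x + 1 \<le> dist b w \<and> geo b w (dist b x) = x"
      by auto
  qed
  then obtain z where z0: "z 0 = y" and step: "\<And>n. dist b (z n) + 1 \<le> dist b (z (Suc n))"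
    and geo_step: "\<And>n. geo b (z (Suc n)) (dist b (z n)) = z n" by blast
  have ge: "real n \<le> dist b (z n)" for n
  proof (induction n)
    case (Suc n) then show ?case using step[of n] by simp
  qed simp
  have "dist b (z n) \<le> dist b (z (Suc n))" for n using step[of n] by simp
  then obtain c where "geodesic_ray c" "c 0 = b" "\<And>n t. 0 \<le> t \<Longrightarrow> t \<le> dist b (z n) \<Longrightarrow> c t = geo b (z n) t"
    using ray_from_chain[of z] ge geo_step by metis
  then show ?thesis using that[of c] z0 geo_end[of b y] by (metis order_refl zero_le_dist)
qed

lemma ray_dist_base:
  "geodesic_ray c \<Longrightarrow> c 0 = b \<Longrightarrow> 0 \<le> t \<Longrightarrow> dist b (c t) = t"
  using ray_is_geodesic(1) by metis

text \<open>The image of the ray is connected, contains 0 and is unbounded, so 0 lies outside the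
  loop.\<close>

lemma winding_number_avoiding_ray:
  assumes c: "geodesic_ray c" "c 0 = b" and \<gamma>: "path \<gamma>" "pathfinish \<gamma> = pathstart \<gamma>"
    and avoid: "\<And>t. 0 \<le> t \<Longrightarrow> h (c t) \<notin> path_image \<gamma>"
  shows "winding_number \<gamma> 0 = 0"
proof -
  let ?C = "h ` c ` {0..}"
  have "continuous_on {0..} c"
    unfolding continuous_on_iff using c(1) by (auto simp: geodesic_ray_def dist_real_def)
  then have "connected ?C"
    by (intro connected_continuous_image continuous_on_h) auto
  moreover have "0 \<in> ?C" using c(2) h_base by force
  moreover have sub: "?C \<subseteq> - path_image \<gamma>" using avoid by auto
  ultimately have "?C \<subseteq> connected_component_set (- path_image \<gamma>) 0"
    by (intro connected_component_maximal) auto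
  moreover have "\<not> bounded ?C"
  proof
    \<comment> \<open>As \<open>h\<close> need not respect distances, boundedness is carried back
      through compactness: \<open>H\<close> maps the compact closure onto a bounded set that
      contains the ray.\<close>
    assume "bounded ?C"
    then have "bounded (H ` closure ?C)"
      by (intro compact_imp_bounded compact_continuous_image continuous_on_H) (simp add: compact_closure)
    moreover have "c ` {0..} \<subseteq> H ` closure ?C"
    proof
      fix x assume x: "x \<in> c ` {0..}"
      then have "h x \<in> closure ?C" by (intro closure_subset[THEN subsetD] imageI)
      then have "H (h x) \<in> H ` closure ?C" by (rule imageI)
      then show "x \<in> H ` closure ?C" by simp
    qed
    ultimately have "bounded (c ` {0..})" by (rule bounded_subset)
    then obtain B where B: "\<And>t. 0 \<le> t \<Longrightarrow> dist b (c t) \<le> B"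
      unfolding bounded_any_center[of _ b] by auto
    from B[of "\<bar>B\<bar> + 1"] ray_dist_base[OF c, of "\<bar>B\<bar> + 1"] show False by simp
  qed
  ultimately have "\<not> bounded (connected_component_set (- path_image \<gamma>) 0)"
    using bounded_subset by blast
  moreover have "0 \<notin> path_image \<gamma>" using avoid[of 0] c(2) h_base by simp
  ultimately have "0 \<in> outside (path_image \<gamma>)" by (simp add: outside_def)
  then show ?thesis using \<gamma> winding_number_zero_in_outside by blast
qed

end

subsection \<open>Metric spheres\<close>

text \<open>\<open>Arg2pi\<close> jumps at 1, but a closed loop hides the jump. The passage from
  homotopic loops to homotopic circle maps, applied to \<open>J\<close> and itself, contains this
  continuity.\<close>

lemma continuous_on_circle_of_loop:
  assumes "path J" "pathfinish J = pathstart J"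
  shows "continuous_on (sphere 0 1) (\<lambda>z. J (Arg2pi z / (2 * pi)))"
proof -
  have "homotopic_loops (path_image J) J J"
    using assms by (simp add: homotopic_loops_refl)
  then show ?thesis
    by (auto dest!: homotopic_loops_imp_homotopic_circlemaps homotopic_with_imp_continuous simp: o_def)
qed

lemma Arg2pi_range: "Arg2pi z / (2 * pi) \<in> {0..<1}"
  using Arg2pi_ge_0[of z] Arg2pi_lt_2pi[of z] by (auto simp: field_simps)

lemma closed_path_circle_homeomorphism:
  fixes J :: "real \<Rightarrow> 'b::t2_space"
  assumes J: "simple_path J" "pathfinish J = pathstart J"
  obtains \<psi> \<phi> where "homeomorphism (sphere 0 1) (path_image J) \<psi> \<phi>"
    "\<And>t. t \<in> {0..1} \<Longrightarrow> \<psi> (cis (2 * pi * t)) = J t"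
proof -
  define \<psi> where "\<psi> = (\<lambda>z. J (Arg2pi z / (2 * pi)))"
  note rng = Arg2pi_range
  have J01: "J 1 = J 0" using J by (simp add: pathfinish_def pathstart_def)
  have "continuous_on (sphere 0 1) \<psi>"
    unfolding \<psi>_def using J by (intro continuous_on_circle_of_loop simple_path_imp_path)
  moreover have at: "\<psi> (cis (2 * pi * t)) = J t" if "t \<in> {0..1}" for t
  proof (cases "t = 1")
    case True
    moreover have "Arg2pi 1 = 0" by (rule Arg2pi_unique[of 1]) auto
    ultimately show ?thesis by (simp add: \<psi>_def J01)
  next
    case False
    then have "Arg2pi (cis (2 * pi * t)) = 2 * pi * t"
      using that by (intro Arg2pi_unique[of 1]) (auto simp: cis_conv_exp)
    then show ?thesis by (simp add: \<psi>_def)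
  qed
  moreover have "\<psi> ` sphere 0 1 = path_image J"
  proof
    show "\<psi> ` sphere 0 1 \<subseteq> path_image J"
      using rng by (force simp: \<psi>_def path_image_def)
    show "path_image J \<subseteq> \<psi> ` sphere 0 1"
      unfolding path_image_def by (force simp flip: at)
  qed
  moreover have "inj_on \<psi> (sphere 0 1)"
  proof (rule inj_onI)
    fix z w :: complex assume zw: "z \<in> sphere 0 1" "w \<in> sphere 0 1" "\<psi> z = \<psi> w"
    let ?a = "Arg2pi z / (2 * pi)" and ?b = "Arg2pi w / (2 * pi)"
    have "?a \<in> {0..1}" "?b \<in> {0..1}" "J ?a = J ?b"
      using rng[of z] rng[of w] zw(3) by (auto simp: \<psi>_def)
    then have "?a = ?b \<or> ?a = 0 \<and> ?b = 1 \<or> ?a = 1 \<and> ?b = 0"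
      using J(1) unfolding simple_path_def loop_free_def by blast
    then have "?a = ?b" using rng[of z] rng[of w] by auto
    then have "Arg2pi z = Arg2pi w" by simp
    then show "z = w" using zw Arg2pi_eq[of z] Arg2pi_eq[of w] by simp
  qed
  ultimately show ?thesis
    using that homeomorphism_compact[of "sphere 0 1" \<psi> "path_image J"] by (metis compact_sphere)
qed

lemma cis_eq_iff_Ints: "cis (2 * pi * s) = cis (2 * pi * t) \<longleftrightarrow> s - t \<in> \<int>"
proof -
  have "cis (2 * pi * s) = cis (2 * pi * t) \<longleftrightarrow> cis (2 * pi * (s - t)) = 1"
    by (simp add: right_diff_distrib flip: cis_divide)
  also have "\<dots> \<longleftrightarrow> s - t \<in> \<int>"
    by (auto simp: complex_eq_iff cos_one_2pi_int cos_one_sin_zero Ints_def)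
  finally show ?thesis .
qed

context cat0_plane
begin

text \<open>The period of the logarithm \<open>\<nu>\<close> says that the curve winds exactly once, counterclockwise,
  around \<open>0\<close>.\<close>

definition circle_lift :: "real \<Rightarrow> (complex \<Rightarrow> 'a) \<Rightarrow> (real \<Rightarrow> complex) \<Rightarrow> bool" where
  "circle_lift r \<psi> \<nu> \<longleftrightarrow> (\<exists>\<phi>. homeomorphism (sphere 0 1) (sphere b r) \<psi> \<phi>) \<and> continuous_on UNIV \<nu> \<and>
     (\<forall>t. h (\<psi> (cis (2 * pi * t))) = exp (\<nu> t)) \<and> (\<forall>t. \<nu> (t + 1) = \<nu> t + 2 * of_real pi * \<i>)"

text \<open>Fixing the orientation together with the homeomorphism pays off in
  \<open>projection_lift\<close>, where the degree is read off from the normalised windings of two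
  circles.\<close>

lemma circle_lift_exists:
  assumes r: "r > 0"
  obtains \<psi> \<nu> where "circle_lift r \<psi> \<nu>"
proof -
  obtain \<rho> where \<rho>: "\<rho> > 0" "\<And>x. dist b x \<le> r \<Longrightarrow> norm (h x) < \<rho>"
    using big_circle by blast
  let ?\<gamma> = "circlepath 0 \<rho>"
  \<comment> \<open>From the large circle itself, proportion 1, to its projection onto the sphere;
    the proportion stays positive, so the loop never meets 0.\<close>
  let ?m = "\<lambda>p::real \<times> real. (1 - fst p) + fst p * (r / dist b (H (?\<gamma> (snd p))))"
  let ?f = "\<lambda>x. h (geo b (H (?\<gamma> x)) r)"
  have far: "dist b (H (?\<gamma> x)) > r" if "x \<in> {0..1}" for x
  proof -
    have "?\<gamma> x \<in> path_image ?\<gamma>" using that by (auto simp: path_image_def)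
    then have "norm (h (H (?\<gamma> x))) = \<rho>" using \<rho> by simp
    then show ?thesis using \<rho>(2)[of "H (?\<gamma> x)"] by force
  qed
  have ends: "?\<gamma> 0 = ?\<gamma> 1" by (simp add: circlepath)
  have "homotopic_loops (- {0}) (\<lambda>x. h (geo b (H (?\<gamma> x)) (?m (0, x) * dist b (H (?\<gamma> x)))))
    (\<lambda>x. h (geo b (H (?\<gamma> x)) (?m (1, x) * dist b (H (?\<gamma> x)))))"
  proof (rule geodesic_loop_homotopy)
    show "continuous_on ({0..1} \<times> {0..1}) ?m"
    proof -
      have "continuous_on ({0..1} \<times> {0..1}) (\<lambda>p::real \<times> real. ?\<gamma> (snd p))"
        using path_circlepath[of 0 \<rho>] unfolding path_def
        by (rule continuous_on_compose2) (auto intro!: continuous_intros)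
      then have "continuous_on ({0..1} \<times> {0..1}) (\<lambda>p::real \<times> real. H (?\<gamma> (snd p)))"
        by (rule continuous_on_compose2[OF continuous_on_H]) auto
      then show ?thesis using far r by (intro continuous_intros) fastforce+
    qed
    fix s x :: real assume sx: "s \<in> {0..1}" "x \<in> {0..1}"
    let ?z = "H (?\<gamma> x)"
    have dz: "dist b ?z > 0" using far[OF sx(2)] r by linarith
    have d: "0 < r / dist b ?z" "r / dist b ?z \<le> 1"
      using far[OF sx(2)] r dz by (auto simp: divide_le_eq_1 intro!: divide_pos_pos simp del: zero_less_dist_iff)
    have m0: "0 < ?m (s, x)"
    proof (cases "s = 1")
      case False
      then show ?thesis unfolding fst_conv snd_conv using sx d
        by (intro add_pos_nonneg mult_nonneg_nonneg) auto
    qed (use d in simp)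
    have "s * (r / dist b ?z) \<le> s" using sx d by (intro mult_left_le) auto
    then have m1: "?m (s, x) \<le> 1" by simp
    from m0 m1 show "0 \<le> ?m (s, x) \<and> ?m (s, x) \<le> 1" by simp
    have "dist b (geo b ?z (?m (s, x) * dist b ?z)) = ?m (s, x) * dist b ?z"
      using m0 m1 by (intro dist_geo) (auto intro: mult_left_le_one_le)
    then have "dist b (geo b ?z (?m (s, x) * dist b ?z)) > 0" using mult_pos_pos[OF m0 dz] by simp
    then show "h (geo b ?z (?m (s, x) * dist b ?z)) \<in> - {0}" by force
  qed (auto simp: ends)
  moreover have "?m (1, x) * dist b (H (?\<gamma> x)) = r" if "x \<in> {0..1}" for x
  proof -
    have "dist b (H (?\<gamma> x)) \<noteq> 0" using far[OF that] r by linarith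
    then show ?thesis by simp
  qed
  ultimately have "homotopic_loops (- {0}) ?\<gamma> ?f"
    unfolding homotopic_loops by simp
  then have w1: "winding_number ?f 0 = 1" and pf: "path ?f" and nz: "0 \<notin> path_image ?f"
    using \<rho>(1) winding_number_homotopic_loops[of 0 ?\<gamma> ?f] winding_number_circlepath[of 0 0 \<rho>]
      homotopic_loops_imp_path[of "- {0}" ?\<gamma> ?f] homotopic_loops_imp_subset[of "- {0}" ?\<gamma> ?f] by auto
  obtain q where q: "path q" "pathfinish q - pathstart q = 2 * of_real pi * \<i> * winding_number ?f 0"
    "\<And>t. t \<in> {0..1} \<Longrightarrow> ?f t = 0 + exp (q t)"
    using winding_number_as_continuous_log[OF pf nz] by blast
  have qne: "pathstart q \<noteq> pathfinish q" using q(2) w1 by auto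
  \<comment> \<open>The logarithmic path may cross itself; the arc does not, and its exponentials
    still lie in the image of the sphere.\<close>
  obtain g where g: "arc g" "path_image g \<subseteq> path_image q" "pathstart g = pathstart q" "pathfinish g = pathfinish q"
    using path_contains_arc[OF q(1) refl refl qne] by blast
  have "pathfinish q = pathstart q + 2 * of_real pi * \<i>" using q(2) w1 by (simp add: algebra_simps)
  then have "exp (pathfinish g) = exp (pathstart g)" using g by (simp add: exp_add)
  then obtain J where J: "simple_path J" "pathfinish J = pathstart J" "path_image J \<subseteq> exp ` path_image g"
    "winding_number J 0 \<noteq> 0"
    using simple_loop_from_exp_arc[OF g(1)] by blast
  have "exp ` path_image q \<subseteq> h ` sphere b r"
  proof
    fix w assume "w \<in> exp ` path_image q"
    then obtain t where t: "t \<in> {0..1}" "w = exp (q t)" by (auto simp: path_image_def)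
    then have "w = ?f t" using q(3) by simp
    moreover have "dist b (geo b (H (?\<gamma> t)) r) = r" using far[OF t(1)] r by (intro dist_geo) auto
    ultimately show "w \<in> h ` sphere b r" by auto
  qed
  then have sub: "path_image J \<subseteq> h ` sphere b r" using J(3) g(2) by blast
  have J_eq: "path_image J = h ` sphere b r"
  proof (rule equalityI[OF sub], rule subsetI, rule ccontr)
    fix w assume "w \<in> h ` sphere b r" and w: "w \<notin> path_image J"
    then obtain y where y: "w = h y" "dist b y = r" by auto
    then have "y \<noteq> b" using r by auto
    then obtain c where c: "geodesic_ray c" "c 0 = b" "c (dist b y) = y" by (rule ray_through)
    have "winding_number J 0 = 0"
    proof (rule winding_number_avoiding_ray[OF c(1,2) simple_path_imp_path[OF J(1)] J(2)])
      fix t :: real assume t: "0 \<le> t"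
      show "h (c t) \<notin> path_image J"
      proof
        assume *: "h (c t) \<in> path_image J"
        then have "c t \<in> sphere b r" using sub by auto
        then have "t = r" using ray_dist_base[OF c(1,2) t] by simp
        then show False using * c(3) y w by simp
      qed
    qed
    with J(4) show False by simp
  qed
  obtain \<psi>0 \<phi>0 where \<psi>0: "homeomorphism (sphere 0 1) (path_image J) \<psi>0 \<phi>0"
    and at: "\<And>t. t \<in> {0..1} \<Longrightarrow> \<psi>0 (cis (2 * pi * t)) = J t"
    using closed_path_circle_homeomorphism[OF J(1,2)] by blast
  have "homeomorphism (path_image J) (sphere b r) H h"
    unfolding homeomorphism_def J_eq
    by (auto simp: image_image intro: continuous_on_H continuous_on_h)
  then have hom: "homeomorphism (sphere 0 1) (sphere b r) (H \<circ> \<psi>0) (\<phi>0 \<circ> h)"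
    using homeomorphism_compose[OF \<psi>0] by blast
  have cont\<psi>0: "continuous_on (sphere 0 1) \<psi>0" using \<psi>0 by (simp add: homeomorphism_def)
  have "continuous_on UNIV (\<lambda>t. \<psi>0 (cis (2 * pi * t)))"
    by (rule continuous_on_compose2[OF cont\<psi>0]) (auto intro!: continuous_intros)
  moreover have "\<psi>0 (cis (2 * pi * t)) \<noteq> 0" for t
  proof -
    have "\<psi>0 (cis (2 * pi * t)) \<in> h ` sphere b r"
      using \<psi>0 unfolding homeomorphism_def J_eq by (metis image_eqI dist_0_norm mem_sphere norm_cis)
    then show ?thesis using r by auto
  qed
  ultimately obtain \<nu> where \<nu>: "continuous_on UNIV \<nu>" "\<And>t. \<psi>0 (cis (2 * pi * t)) = exp (\<nu> t)"
    using continuous_logarithm_on_contractible[of UNIV "\<lambda>t. \<psi>0 (cis (2 * pi * t))"]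
    by (metis UNIV_I contractible_UNIV)
  have "cis (2 * pi * (t + 1)) = cis (2 * pi * t)" for t unfolding cis_eq_iff_Ints by simp
  then have "exp (\<nu> (t + 1)) = exp (\<nu> t)" for t by (metis \<nu>(2))
  then obtain k where k: "\<And>t. \<nu> (t + 1) = \<nu> t + 2 * of_real pi * \<i> * of_int k"
    using exp_lift_period[OF \<nu>(1)] by blast
  have "winding_number J 0 = winding_number (exp \<circ> \<nu>) 0"
    by (rule winding_number_cong) (simp add: at flip: \<nu>(2))
  also have "\<dots> = (\<nu> 1 - \<nu> 0) / (2 * of_real pi * \<i>)"
    using \<nu>(1) continuous_on_subset by (subst winding_number_compose_exp) (auto simp: path_def pathfinish_def pathstart_def)
  also have "\<dots> = of_int k" using k[of 0] by simp
  finally have wk: "winding_number J 0 = of_int k" .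
  have "0 \<notin> path_image J" using J_eq r by auto
  \<comment> \<open>A Jordan curve winds at most once; as 0 is excluded, only the orientation is
    left open.\<close>
  then have "winding_number J 0 \<in> {-1, 0, 1}"
    using simple_closed_path_winding_number_cases J by blast
  then have "k = 1 \<or> k = -1" using wk J(4) by (auto simp: complex_eq_iff)
  then show ?thesis
  proof
    assume "k = 1"
    then have "circle_lift r (H \<circ> \<psi>0) \<nu>"
      unfolding circle_lift_def using hom \<nu> k by auto
    then show ?thesis by (rule that)
  next
    \<comment> \<open>Conjugation reverses the circle, and the logarithm is run backwards
      accordingly.\<close>
    assume k1: "k = -1"
    have "homeomorphism (sphere 0 1) (sphere 0 1) cnj cnj"
      unfolding homeomorphism_def by (auto intro!: continuous_intros image_eqI[where x = "cnj _"])
    then have "homeomorphism (sphere 0 1) (sphere b r) ((H \<circ> \<psi>0) \<circ> cnj) (cnj \<circ> (\<phi>0 \<circ> h))"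
      using homeomorphism_compose hom by blast
    moreover have "continuous_on UNIV (\<lambda>t. \<nu> (- t))"
      by (rule continuous_on_compose2[OF \<nu>(1)]) (auto intro!: continuous_intros)
    moreover have "h ((H \<circ> \<psi>0 \<circ> cnj) (cis (2 * pi * t))) = exp (\<nu> (- t))" for t
      using \<nu>(2)[of "- t"] by (simp add: cis_cnj)
    moreover have "\<nu> (- (t + 1)) = \<nu> (- t) + 2 * of_real pi * \<i>" for t
      using k[of "- (t + 1)"] k1 by simp
    ultimately have "circle_lift r ((H \<circ> \<psi>0) \<circ> cnj) (\<lambda>t. \<nu> (- t))"
      unfolding circle_lift_def by blast
    then show ?thesis by (rule that)
  qed
qed

end

subsection \<open>Radial projections between spheres\<close>

context cat0_plane
begin

context
  fixes r \<psi> \<nu> \<tau>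
  assumes r: "r > 0" and lift: "circle_lift r \<psi> \<nu>"
  defines "\<tau> \<equiv> \<lambda>t. \<psi> (cis (2 * pi * t))"
begin

lemma continuous_on_circle_lift: "continuous_on A \<tau>"
proof -
  have "continuous_on (sphere 0 1) \<psi>" using lift by (auto simp: circle_lift_def homeomorphism_def)
  then show ?thesis unfolding \<tau>_def
    by (rule continuous_on_compose2) (auto intro!: continuous_intros)
qed

lemma dist_circle_lift: "dist b (\<tau> t) = r"
proof -
  have "\<tau> t \<in> \<psi> ` sphere 0 1" unfolding \<tau>_def by (rule imageI) simp
  then show ?thesis using lift by (auto simp: circle_lift_def homeomorphism_def)
qed

lemma circle_lift_eq_iff: "\<tau> s = \<tau> t \<longleftrightarrow> s - t \<in> \<int>"
proof -
  obtain \<phi> where "homeomorphism (sphere 0 1) (sphere b r) \<psi> \<phi>" using lift by (auto simp: circle_lift_def)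
  then have "inj_on \<psi> (sphere 0 1)" by (metis homeomorphism_apply1 inj_on_inverseI)
  then have "\<tau> s = \<tau> t \<longleftrightarrow> cis (2 * pi * s) = cis (2 * pi * t)"
    unfolding \<tau>_def by (subst inj_on_eq_iff) auto
  then show ?thesis by (simp add: cis_eq_iff_Ints)
qed

lemma circle_lift_surj:
  assumes "dist b y = r"
  obtains t where "\<tau> t = y"
proof -
  have "y \<in> \<psi> ` sphere 0 1" using lift assms by (auto simp: circle_lift_def homeomorphism_def)
  then obtain z where z: "norm z = 1" "y = \<psi> z" by auto
  then have "z = cis (2 * pi * (Arg z / (2 * pi)))"
    using rcis_cmod_Arg[of z] by (simp add: rcis_def)
  then show ?thesis using z that[of "Arg z / (2 * pi)"] by (simp add: \<tau>_def)
qed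

text \<open>On the contractible line the unit numbers \<open>\<phi> (f t)\<close> have a continuous
  logarithm, purely imaginary; its imaginary part over \<open>2 * pi\<close> is the lifted
  parameter.\<close>

lemma circle_lift_path_lift:
  fixes f :: "real \<Rightarrow> 'a"
  assumes f: "continuous_on UNIV f" "\<And>t. dist b (f t) = r"
  obtains g where "continuous_on UNIV g" "\<And>t. f t = \<tau> (g t)"
proof -
  obtain \<phi> where \<phi>: "homeomorphism (sphere 0 1) (sphere b r) \<psi> \<phi>" using lift by (auto simp: circle_lift_def)
  then have c\<phi>: "continuous_on (sphere b r) \<phi>" and n: "norm (\<phi> (f t)) = 1" and inv: "\<psi> (\<phi> (f t)) = f t" for t
    using f(2)[of t] by (force simp: homeomorphism_def)+
  have "continuous_on UNIV (\<lambda>t. \<phi> (f t))"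
    by (rule continuous_on_compose2[OF c\<phi> f(1)]) (use f(2) in auto)
  moreover have "\<phi> (f t) \<noteq> 0" for t using n[of t] by auto
  ultimately obtain q where q: "continuous_on UNIV q" "\<And>t. \<phi> (f t) = exp (q t)"
    using continuous_logarithm_on_contractible[of UNIV "\<lambda>t. \<phi> (f t)"] by (metis UNIV_I contractible_UNIV)
  show ?thesis
  proof
    show "continuous_on UNIV (\<lambda>t. Im (q t) / (2 * pi))" by (intro continuous_intros q) auto
    fix t
    have "Re (q t) = 0" using n[of t] q(2)[of t] by simp
    then have "exp (q t) = cis (Im (q t))" by (simp add: exp_eq_polar)
    then have "\<phi> (f t) = cis (2 * pi * (Im (q t) / (2 * pi)))" using q(2)[of t] by simp
    then show "f t = \<tau> (Im (q t) / (2 * pi))" using inv[of t] by (simp add: \<tau>_def)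
  qed
qed

lemma circle_lift_exp: "h (\<tau> t) = exp (\<nu> t)" and continuous_on_circle_log: "continuous_on A \<nu>"
  and circle_log_add_int: "\<nu> (t + of_int n) = \<nu> t + of_int n * (2 * of_real pi * \<i>)"
  using lift lift_add_int[of \<nu> "2 * of_real pi * \<i>"] continuous_on_subset[of UNIV \<nu> A]
  unfolding circle_lift_def \<tau>_def by auto

lemma winding_number_circle_lift:
  assumes "continuous_on {0..1} g"
  shows "path (\<lambda>x. h (\<tau> (g x)))"
    "winding_number (\<lambda>x. h (\<tau> (g x))) 0 = (\<nu> (g 1) - \<nu> (g 0)) / (2 * of_real pi * \<i>)"
proof -
  have p: "path (\<nu> \<circ> g)"
    unfolding path_def by (rule continuous_on_compose[OF assms continuous_on_circle_log])
  have eq: "(\<lambda>x. h (\<tau> (g x))) = exp \<circ> (\<nu> \<circ> g)" by (auto simp: circle_lift_exp)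
  show "path (\<lambda>x. h (\<tau> (g x)))"
    unfolding eq by (intro path_continuous_image[OF p] continuous_intros)
  show "winding_number (\<lambda>x. h (\<tau> (g x))) 0 = (\<nu> (g 1) - \<nu> (g 0)) / (2 * of_real pi * \<i>)"
    unfolding eq winding_number_compose_exp[OF p] by (simp add: pathfinish_def pathstart_def)
qed

end

context
  fixes r R \<psi> \<psi>' \<nu> \<nu>' \<tau> \<tau>'
  assumes r: "0 < r" "r \<le> R" and lifts: "circle_lift r \<psi> \<nu>" "circle_lift R \<psi>' \<nu>'"
  defines \<tau>_def: "\<tau> \<equiv> \<lambda>t. \<psi> (cis (2 * pi * t))" and \<tau>'_def: "\<tau>' \<equiv> \<lambda>t. \<psi>' (cis (2 * pi * t))"
begin

lemma inner_circle_eq: "\<psi> (cis (2 * pi * t)) = \<tau> t" and outer_circle_eq: "\<psi>' (cis (2 * pi * t)) = \<tau>' t"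
  by (simp_all add: \<tau>_def \<tau>'_def)

lemma outer_radius_pos: "R > 0" using r by simp

lemmas inner_circle = continuous_on_circle_lift[OF r(1) lifts(1), unfolded inner_circle_eq]
  dist_circle_lift[OF r(1) lifts(1), unfolded inner_circle_eq]
  circle_lift_eq_iff[OF r(1) lifts(1), unfolded inner_circle_eq]
lemmas outer_circle = continuous_on_circle_lift[OF outer_radius_pos lifts(2), unfolded outer_circle_eq]
  dist_circle_lift[OF outer_radius_pos lifts(2), unfolded outer_circle_eq]
  circle_lift_eq_iff[OF outer_radius_pos lifts(2), unfolded outer_circle_eq]

text \<open>The loop formed by an arc of the outer circle and the curve \<open>c\<close> has winding number zero, because
  the ray through \<open>\<tau>' e\<close> avoids it.\<close>

lemma winding_number_arc_and_connection:
  assumes pq: "p \<le> q" "e < p" "q < e + 1"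
    and e: "geo b (\<tau>' e) r \<noteq> y"
    and c: "path c" "pathstart c = h (\<tau>' q)" "pathfinish c = h (\<tau>' p)"
    and c_image: "\<And>w. w \<in> path_image c \<Longrightarrow> \<exists>x. w = h x \<and> r \<le> dist b x \<and> dist b x \<le> R \<and> geo b x r = y"
  shows "(\<nu>' q - \<nu>' p) / (2 * of_real pi * \<i>) + winding_number c 0 = 0"
proof -
  let ?A = "\<lambda>x. h (\<tau>' (p + (q - p) * x))"
  have "continuous_on {0..1} (\<lambda>x. p + (q - p) * x)" by (intro continuous_intros)
  note A = winding_number_circle_lift[OF outer_radius_pos lifts(2) this, unfolded outer_circle_eq]
  have range: "p \<le> p + (q - p) * x \<and> p + (q - p) * x \<le> q" if "x \<in> {0..1}" for x
  proof -
    have "0 \<le> (q - p) * x" "(q - p) * x \<le> q - p" using that pq by (auto intro: mult_left_le)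
    then show ?thesis by simp
  qed
  have ends: "pathfinish ?A = pathstart c" "pathstart ?A = pathfinish c"
    using c by (auto simp: pathfinish_def pathstart_def)
  have "\<tau>' e \<noteq> b" using outer_circle(2)[of e] outer_radius_pos by auto
  then obtain \<rho> where \<rho>: "geodesic_ray \<rho>" "\<rho> 0 = b" "\<rho> (dist b (\<tau>' e)) = \<tau>' e" by (rule ray_through)
  then have \<rho>R: "\<rho> R = \<tau>' e" by (simp add: outer_circle(2))
  have "winding_number (?A +++ c) 0 = 0"
  proof (rule winding_number_avoiding_ray[OF \<rho>(1,2)])
    show "path (?A +++ c)" using A(1) c(1) ends by (intro path_join_imp)
    show "pathfinish (?A +++ c) = pathstart (?A +++ c)" using ends by simp
    fix t :: real assume t: "0 \<le> t"
    have dt: "dist b (\<rho> t) = t" using ray_dist_base \<rho> t by blast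
    \<comment> \<open>The ray meets the outer circle only in \<open>\<tau>' e\<close>, and the arc
      misses this point because \<open>p\<close> and \<open>q\<close> lie strictly between
      \<open>e\<close> and \<open>e + 1\<close>.\<close>
    have "h (\<rho> t) \<notin> path_image ?A"
    proof
      assume "h (\<rho> t) \<in> path_image ?A"
      then obtain x where x: "x \<in> {0..1}" "\<rho> t = \<tau>' (p + (q - p) * x)" by (auto simp: path_image_def)
      then have "t = R" using dt outer_circle(2) by simp
      then have "\<tau>' (p + (q - p) * x) = \<tau>' e" using x \<rho>R by simp
      then have "p + (q - p) * x - e \<in> \<int>" by (simp only: outer_circle(3))
      moreover have "0 < p + (q - p) * x - e" "p + (q - p) * x - e < 1" using range[OF x(1)] pq by linarith+
      ultimately show False by (metis Ints_cases of_int_0_less_iff of_int_less_1_iff zless_imp_add1_zle add_0 linorder_not_le)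
    qed
    \<comment> \<open>Every point of \<open>c\<close> projects to \<open>y\<close>, while the ray
      crosses the inner sphere at the projection of \<open>\<tau>' e\<close>.\<close>
    moreover have "h (\<rho> t) \<notin> path_image c"
    proof
      assume "h (\<rho> t) \<in> path_image c"
      then have t: "r \<le> t" "t \<le> R" and "geo b (\<rho> t) r = y" using c_image[of "h (\<rho> t)"] dt by auto
      moreover have "geo b (\<rho> t) r = \<rho> r" "geo b (\<rho> R) r = \<rho> r"
        using geo_ray[OF \<rho>(1), of r] \<rho>(2) t r by auto
      ultimately show False using e \<rho>R by simp
    qed
    ultimately show "h (\<rho> t) \<notin> path_image (?A +++ c)" using path_image_join_subset by blast
  qed
  moreover have "0 \<notin> path_image ?A"
    using dist_circle_lift[OF outer_radius_pos lifts(2), unfolded outer_circle_eq] outer_radius_pos by (force simp: path_image_def)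
  moreover have "0 \<notin> path_image c"
  proof
    assume "0 \<in> path_image c"
    then obtain x where "0 = h x" "r \<le> dist b x" using c_image by blast
    then show False using r h_eq_0_iff[of x] by simp
  qed
  ultimately have "winding_number ?A 0 + winding_number c 0 = 0"
    using winding_number_join[OF A(1) _ c(1)] ends by simp
  then show ?thesis using A(2) by simp
qed

text \<open>Otherwise joining \<open>\<tau>' u1\<close> and \<open>\<tau>' u2\<close> through \<open>y\<close> would cut the outer circle into
  two loops of winding number zero, whereas the winding numbers of the two add up to one.\<close>

lemma projection_fibre_separation:
  assumes u: "s < u1" "u1 < t" "t < u2" "u2 < s + 1"
    and y: "geo b (\<tau>' u1) r = y" "geo b (\<tau>' u2) r = y"
  shows "geo b (\<tau>' s) r = y \<or> geo b (\<tau>' t) r = y"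
proof (rule ccontr)
  assume contr: "\<not> ?thesis"
  \<comment> \<open>The geodesic from \<open>z\<close> inward, from radius \<open>R\<close> at
    \<open>x = 0\<close> to radius \<open>r\<close> at \<open>x = 1\<close>; the two curves used
    here both end in \<open>y\<close>.\<close>
  define c where "c = (\<lambda>z x. h (geo b z ((1 - x) * R + x * r)))"
  have rng: "r \<le> (1 - x) * R + x * r \<and> (1 - x) * R + x * r \<le> R" if "x \<in> {0..1}" for x
  proof -
    have "0 \<le> (1 - x) * (R - r)" "0 \<le> x * (R - r)" using that r by auto
    then show ?thesis by (simp add: algebra_simps)
  qed
  have c_path: "path (c z)" if "dist b z = R" for z
  proof -
    have "continuous_on {0..R} (geo b z)"
      unfolding continuous_on_iff using that by (auto simp: dist_geo_geo dist_real_def)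
    moreover have "continuous_on {0..1} (\<lambda>x. (1 - x) * R + x * r)" by (intro continuous_intros)
    moreover have "(\<lambda>x. (1 - x) * R + x * r) ` {0..1} \<subseteq> {0..R}" using rng r by force
    ultimately have "continuous_on {0..1} (\<lambda>x. geo b z ((1 - x) * R + x * r))"
      by (rule continuous_on_compose2)
    then show ?thesis unfolding path_def c_def by (rule continuous_on_compose2[OF continuous_on_h]) auto
  qed
  have c_image: "\<exists>x. w = h x \<and> r \<le> dist b x \<and> dist b x \<le> R \<and> geo b x r = y"
    if z: "dist b z = R" "geo b z r = y" and w: "w \<in> path_image (c z)" for z w
  proof -
    obtain x where x: "x \<in> {0..1}" "w = c z x" using w by (auto simp: path_image_def)
    let ?l = "(1 - x) * R + x * r"
    have "dist b (geo b z ?l) = ?l" using rng[OF x(1)] r z by (intro dist_geo) auto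
    moreover have "geo b (geo b z ?l) r = y" using geo_geo[of r ?l b z] rng[OF x(1)] r z by simp
    ultimately show ?thesis using x rng[OF x(1)] by (auto simp: c_def)
  qed
  let ?c1 = "c (\<tau>' u1)" and ?c2 = "c (\<tau>' u2)"
  let ?c = "?c1 +++ reversepath ?c2"
  have paths: "path ?c1" "path ?c2" by (auto intro!: c_path outer_circle(2))
  have start: "c z 0 = h z" if "dist b z = R" for z using that geo_end[of b z] by (simp add: c_def)
  have ends: "pathstart ?c1 = h (\<tau>' u1)" "pathstart ?c2 = h (\<tau>' u2)" "pathfinish ?c1 = pathfinish ?c2"
    using y start outer_circle(2) by (auto simp: pathstart_def pathfinish_def c_def)
  have pc: "path ?c" using paths ends by (intro path_join_imp path_reversepath) simp_all
  have image: "\<exists>x. w = h x \<and> r \<le> dist b x \<and> dist b x \<le> R \<and> geo b x r = y" if "w \<in> path_image ?c" for w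
  proof -
    have "w \<in> path_image ?c1 \<or> w \<in> path_image ?c2"
      using that path_image_join_subset by fastforce
    then show ?thesis using c_image y outer_circle(2) by blast
  qed
  have "\<tau>' (u1 + 1) = \<tau>' u1" by (simp add: outer_circle(3))
  \<comment> \<open>Reversed, \<open>?c\<close> closes the arc from \<open>u1\<close> to
    \<open>u2\<close>, which misses \<open>s\<close>; forward, it closes the arc from
    \<open>u2\<close> to \<open>u1 + 1\<close>, which misses \<open>t\<close>. In the sum the
    contributions of \<open>?c\<close> cancel.\<close>
  have "(\<nu>' u2 - \<nu>' u1) / (2 * of_real pi * \<i>) + winding_number (reversepath ?c) 0 = 0"
    using u contr pc ends image
    by (intro winding_number_arc_and_connection[where e = s and y = y]) auto
  moreover have "(\<nu>' (u1 + 1) - \<nu>' u2) / (2 * of_real pi * \<i>) + winding_number ?c 0 = 0"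
    using u contr pc ends image \<open>\<tau>' (u1 + 1) = \<tau>' u1\<close>
    by (intro winding_number_arc_and_connection[where e = t and y = y]) auto
  moreover have "0 \<notin> path_image ?c"
  proof
    assume "0 \<in> path_image ?c"
    then obtain x where "0 = h x" "r \<le> dist b x" using image by blast
    then show False using r h_eq_0_iff[of x] by simp
  qed
  then have "winding_number (reversepath ?c) 0 = - winding_number ?c 0"
    by (rule winding_number_reversepath[OF pc])
  moreover have "\<nu>' (u1 + 1) = \<nu>' u1 + 2 * of_real pi * \<i>" using lifts(2) by (simp add: circle_lift_def)
  ultimately show False by (simp add: field_simps)
qed

text \<open>The projection lifts to the line with some integer degree \<open>k\<close>. Moving the
  outer circle inward along geodesics in the punctured plane gives \<open>k = 1\<close>, and a
  decrease of \<open>g\<close> would produce a fibre forbidden by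
  \<open>projection_fibre_separation\<close>.\<close>

lemma projection_lift:
  obtains g where "continuous_on UNIV g" "\<And>t. geo b (\<tau>' t) r = \<tau> (g t)" "mono g" "\<And>t. g (t + 1) = g t + 1"
proof -
  have "continuous_on UNIV (\<lambda>t. geo b (\<tau>' t) r)"
    by (rule continuous_on_compose2[OF continuous_on_geo_radius[OF r(1)] outer_circle(1)]) (use outer_circle(2) r in auto)
  moreover have "dist b (geo b (\<tau>' t) r) = r" for t using r outer_circle(2) by (intro dist_geo) auto
  ultimately obtain g where g: "continuous_on UNIV g" "\<And>t. geo b (\<tau>' t) r = \<tau> (g t)"
    using circle_lift_path_lift[OF r(1) lifts(1), unfolded inner_circle_eq, of "\<lambda>t. geo b (\<tau>' t) r"] by blast
  have per: "\<tau>' (t + 1) = \<tau>' t" for t by (simp add: outer_circle(3))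
  have cont2: "continuous_on UNIV (\<lambda>t. 2 * of_real pi * \<i> * of_real (g t))"
    by (intro continuous_intros g)
  have "exp (2 * of_real pi * \<i> * of_real (g (t + 1))) = exp (2 * of_real pi * \<i> * of_real (g t))" for t
  proof -
    have "g (t + 1) - g t \<in> \<int>" using g(2)[of t] g(2)[of "t + 1"] by (simp add: per flip: inner_circle(3))
    then have "cis (2 * pi * g (t + 1)) = cis (2 * pi * g t)" by (simp add: cis_eq_iff_Ints)
    then show ?thesis by (simp add: cis_conv_exp mult_ac)
  qed
  then obtain k where "\<And>t. 2 * of_real pi * \<i> * of_real (g (t + 1)) = 2 * of_real pi * \<i> * of_real (g t)
      + 2 * of_real pi * \<i> * of_int k" using exp_lift_period[OF cont2] by blast
  then have "2 * of_real pi * \<i> * of_real (g (t + 1)) = 2 * of_real pi * \<i> * (of_real (g t) + of_int k)" for t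
    by (simp add: distrib_left)
  then have "complex_of_real (g (t + 1)) = of_real (g t + of_int k)" for t by simp
  then have k: "g (t + 1) = g t + of_int k" for t using of_real_eq_iff by blast
  have "k = 1"
  proof -
    let ?m = "\<lambda>p::real \<times> real. (1 - fst p) + fst p * (r / R)"
    let ?\<gamma> = "\<lambda>x. h (\<tau>' x)"
    have id: "continuous_on {0..1} (\<lambda>x. x :: real)" by (intro continuous_intros)
    note w\<gamma> = winding_number_circle_lift[OF outer_radius_pos lifts(2) id, unfolded outer_circle_eq]
    have "homotopic_loops (- {0}) (\<lambda>x. h (geo b (H (?\<gamma> x)) (?m (0, x) * dist b (H (?\<gamma> x)))))
      (\<lambda>x. h (geo b (H (?\<gamma> x)) (?m (1, x) * dist b (H (?\<gamma> x)))))"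
    proof (rule geodesic_loop_homotopy)
      show "path ?\<gamma>" by (rule w\<gamma>(1))
      show "pathfinish ?\<gamma> = pathstart ?\<gamma>" using per[of 0] by (simp add: pathfinish_def pathstart_def)
      fix s x :: real assume sx: "s \<in> {0..1}" "x \<in> {0..1}"
      have d: "0 < r / R" "r / R \<le> 1" using r by auto
      have m0: "0 < ?m (s, x)"
      proof (cases "s = 1")
        case False
        then show ?thesis unfolding fst_conv snd_conv using sx d
          by (intro add_pos_nonneg mult_nonneg_nonneg) auto
      qed (use d in simp)
      have "s * (r / R) \<le> s" using sx d by (intro mult_left_le) auto
      then have m1: "?m (s, x) \<le> 1" by simp
      from m0 m1 show "0 \<le> ?m (s, x) \<and> ?m (s, x) \<le> 1" by simp
      have "dist b (geo b (\<tau>' x) (?m (s, x) * R)) = ?m (s, x) * R"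
        using m0 m1 outer_radius_pos outer_circle(2)[of x] by (intro dist_geo) (auto intro: mult_left_le_one_le)
      then have "dist b (geo b (\<tau>' x) (?m (s, x) * R)) > 0" using mult_pos_pos[OF m0 outer_radius_pos] by simp
      then show "h (geo b (H (?\<gamma> x)) (?m (s, x) * dist b (H (?\<gamma> x)))) \<in> - {0}"
        using outer_circle(2)[of x] by force
    qed (use outer_radius_pos in \<open>auto intro!: continuous_intros\<close>)
    then have "homotopic_loops (- {0}) ?\<gamma> (\<lambda>x. h (\<tau> (g x)))"
      using geo_end[of b "\<tau>' _", unfolded outer_circle(2)] outer_radius_pos by (simp add: outer_circle(2) g(2))
    then have "winding_number ?\<gamma> 0 = winding_number (\<lambda>x. h (\<tau> (g x))) 0"
      by (rule winding_number_homotopic_loops)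
    also have "\<dots> = (\<nu> (g 1) - \<nu> (g 0)) / (2 * of_real pi * \<i>)"
      using winding_number_circle_lift[OF r(1) lifts(1), unfolded inner_circle_eq] g(1) continuous_on_subset by blast
    also have "\<nu> (g 1) = \<nu> (g 0) + of_int k * (2 * of_real pi * \<i>)"
      using k[of 0] circle_log_add_int[OF r(1) lifts(1), of "g 0" k] by simp
    finally have "winding_number ?\<gamma> 0 = of_int k" by simp
    moreover have "winding_number ?\<gamma> 0 = 1"
      using w\<gamma>(2) lifts(2) unfolding circle_lift_def by (metis add_0 add_diff_cancel_left' divide_self_if
          mult_eq_0_iff complex_i_not_zero of_real_eq_0_iff pi_neq_zero zero_neq_numeral)
    ultimately have "complex_of_int k = of_int 1" by simp
    then show "k = 1" by (simp only: of_int_eq_iff)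
  qed
  then have g1: "g (t + 1) = g t + 1" for t using k by simp
  have g_int: "g (t + of_int n) = g t + of_int n" for t n
    using lift_add_int[of g 1] g1 by simp
  have "mono g"
  proof (rule monoI, rule ccontr)
    fix s t0 :: real assume le: "s \<le> t0" and "\<not> g s \<le> g t0"
    \<comment> \<open>Whole turns are removed from \<open>t0\<close>; each lowers \<open>g\<close>
      by 1, so the decrease survives, now with \<open>t < s + 1\<close>.\<close>
    define t where "t = t0 - of_int \<lfloor>t0 - s\<rfloor>"
    have "\<lfloor>t0 - s\<rfloor> \<ge> 0" using le by simp
    moreover have "g t0 = g t + of_int \<lfloor>t0 - s\<rfloor>" using g_int[of t "\<lfloor>t0 - s\<rfloor>"] by (simp add: t_def)
    ultimately have less: "g t < g s" using \<open>\<not> g s \<le> g t0\<close> by (smt (verit) of_int_0_le_iff)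
    have "s \<le> t" "t < s + 1" unfolding t_def by linarith+
    with less have st: "s < t" "t < s + 1" by (cases "s = t"; simp)+
    \<comment> \<open>Such a \<open>v\<close> is taken in \<open>(s, t)\<close> on the way from
      \<open>g s\<close> down to \<open>g t\<close>, and again in \<open>(t, s + 1)\<close> on the
      way up to \<open>g s + 1\<close>, yet is congruent to neither \<open>g s\<close> nor
      \<open>g t\<close> modulo 1. Two candidates at distance \<open>d < 1\<close> cannot both be
      congruent to \<open>g s\<close>.\<close>
    obtain v where v: "g t < v" "v < g s" "v < g t + 1" "v - g s \<notin> \<int>"
    proof -
      define d where "d = min 1 (g s - g t) / 3"
      have d: "0 < d" "3 * d \<le> 1" "3 * d \<le> g s - g t" using less by (auto simp: d_def)
      have "g t + d - g s \<notin> \<int> \<or> g t + 2 * d - g s \<notin> \<int>"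
      proof (rule ccontr)
        assume "\<not> ?thesis"
        then have "(g t + 2 * d - g s) - (g t + d - g s) \<in> \<int>" using Ints_diff by blast
        then have "d \<in> \<int>" by simp
        then show False using d by (auto elim!: Ints_cases)
      qed
      then show ?thesis using that[of "g t + d"] that[of "g t + 2 * d"] d by auto
    qed
    have cont: "continuous_on A g" for A using g(1) continuous_on_subset by blast
    obtain u1 where u1: "s \<le> u1" "u1 \<le> t" "g u1 = v"
      using IVT2'[of g t v s] v st cont by auto
    obtain u2 where u2: "t \<le> u2" "u2 \<le> s + 1" "g u2 = v"
      using IVT'[of g t v "s + 1"] v st cont g1[of s] by auto
    have "u1 \<noteq> s" "u1 \<noteq> t" "u2 \<noteq> t" "u2 \<noteq> s + 1" using u1 u2 v g1[of s] by auto
    then have "geo b (\<tau>' s) r = \<tau> v \<or> geo b (\<tau>' t) r = \<tau> v"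
      using u1 u2 by (intro projection_fibre_separation[of s u1 t u2]) (auto simp: g(2))
    then have "v - g s \<in> \<int> \<or> v - g t \<in> \<int>"
      unfolding g(2) by (metis inner_circle(3))
    moreover have "v - g t \<notin> \<int>"
    proof
      assume "v - g t \<in> \<int>"
      then obtain z where "v - g t = of_int z" by (auto elim: Ints_cases)
      then have "0 < real_of_int z" "real_of_int z < 1" using v by linarith+
      then show False by simp
    qed
    ultimately show False using v by blast
  qed
  then show ?thesis using that g g1 by blast
qed

end
end

subsection \<open>Inverse limits of monotone circle maps\<close>

definition thread :: "(nat \<Rightarrow> 'a \<Rightarrow> 'a) \<Rightarrow> (nat \<Rightarrow> 'a) \<Rightarrow> bool" where
  "thread g t \<longleftrightarrow> (\<forall>n. g n (t (Suc n)) = t n)"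

text \<open>Coordinates above \<open>N\<close> are chosen by surjectivity, those below are forced;
  the induction peels off the bottom map of the system.\<close>

lemma thread_through:
  assumes "\<And>n. surj (g n)"
  obtains t where "thread g t" "t N = s"
  using assms
proof (induction N arbitrary: g thesis)
  case 0
  have "\<exists>t. \<forall>n. (n = 0 \<longrightarrow> t n = s) \<and> g n (t (Suc n)) = t n"
  proof (rule dependent_nat_choice)
    show "\<exists>y. (Suc n = 0 \<longrightarrow> y = s) \<and> g n y = x" for x n
      using 0(2)[of n] by (metis nat.distinct(1) surjD)
  qed auto
  then show ?case using 0(1) by (auto simp: thread_def)
next
  case (Suc N)
  obtain t where t: "thread (\<lambda>n. g (Suc n)) t" "t N = s" using Suc.IH[of "\<lambda>n. g (Suc n)"] Suc.prems(2) by blast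
  let ?t = "case_nat (g 0 (t 0)) t"
  have "thread g ?t" using t(1) by (auto simp: thread_def split: nat.split)
  moreover have "?t (Suc N) = s" using t(2) by simp
  ultimately show ?case by (rule Suc.prems(1))
qed

text \<open>The composite bonding map from level \<open>n + k\<close> down to level
  \<open>n\<close>.\<close>

fun descend :: "(nat \<Rightarrow> 'a \<Rightarrow> 'a) \<Rightarrow> nat \<Rightarrow> nat \<Rightarrow> 'a \<Rightarrow> 'a" where
  "descend g n 0 s = s"
| "descend g n (Suc k) s = descend g n k (g (n + k) s)"

lemma descend_thread: "thread g t \<Longrightarrow> descend g n k (t (n + k)) = t n"
  by (induction k) (auto simp: thread_def)

text \<open>Lifts of monotone degree-one circle maps. The normalisation \<open>base\<close> makes
  every constant integer sequence a thread, and these threads serve as barriers for all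
  others.\<close>

locale circle_inverse_system =
  fixes g :: "nat \<Rightarrow> real \<Rightarrow> real"
  assumes cont: "continuous_on UNIV (g n)" and mono: "mono (g n)"
    and period: "g n (t + 1) = g n t + 1" and base: "g n 0 = 0"
begin

lemma add_int: "g n (t + of_int k) = g n t + of_int k"
  using lift_add_int[of "g n" 1] period by simp

lemma at_int: "g n (of_int k) = of_int k"
  using add_int[of n 0 k] by (simp add: base)

lemma surj_step: "surj (g n)"
proof -
  have "\<exists>x. y = g n x" for y
  proof -
    have "continuous_on A (g n)" for A using cont continuous_on_subset by blast
    then have "\<exists>x\<ge>of_int \<lfloor>y\<rfloor>. x \<le> of_int (\<lfloor>y\<rfloor> + 1) \<and> g n x = y"
      by (intro IVT') (auto simp: at_int at_int[of n "\<lfloor>y\<rfloor> + 1", simplified])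
    then show ?thesis by blast
  qed
  then show ?thesis by (simp add: surj_def)
qed

lemma thread_le:
  assumes "thread g s" "thread g t" "n \<le> m" "s m \<le> t m"
  shows "s n \<le> t n"
  using assms(3)
proof (induction n rule: inc_induct)
  case (step k)
  then show ?case using monoD[OF mono[of k], of "s (Suc k)" "t (Suc k)"] assms(1,2) by (simp add: thread_def)
qed (use assms in simp)

text \<open>A comparison at one level passes to all lower levels, so strict inequalities in opposite
  directions at two levels would contradict each other at the lower one.\<close>

lemma thread_linear:
  assumes "thread g s" "thread g t"
  shows "(\<forall>n. s n \<le> t n) \<or> (\<forall>n. t n \<le> s n)"
  using thread_le[OF assms] thread_le[OF assms(2,1)] by (metis linorder_linear)

lemma thread_int: "thread g (\<lambda>n. of_int k)"
  by (simp add: thread_def at_int)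

lemma thread_plus1: "thread g t \<Longrightarrow> thread g (\<lambda>n. t n + 1)"
  by (simp add: thread_def period)

text \<open>At and below level \<open>m\<close>, the thread stays between the integer threads given
  by the floor of \<open>t m\<close> and its successor.\<close>

lemma thread_near:
  assumes "thread g t"
  shows "\<bar>t m - t n\<bar> \<le> 1"
proof -
  have *: "\<bar>t m - t n\<bar> \<le> 1" if "n \<le> m" for n m
  proof -
    have "of_int \<lfloor>t m\<rfloor> \<le> t n" by (rule thread_le[OF thread_int assms that]) simp
    moreover have "t n \<le> of_int (\<lfloor>t m\<rfloor> + 1)" by (rule thread_le[OF assms thread_int that]) linarith
    moreover have "real_of_int (\<lfloor>t m\<rfloor> + 1) = of_int \<lfloor>t m\<rfloor> + 1" by simp
    ultimately show ?thesis by linarith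
  qed
  show ?thesis using *[of n m] *[of m n] by (cases "n \<le> m") (auto simp: abs_minus_commute)
qed

section \<open>Parametrizing threads by a weighted mean\<close>

definition weight :: "(nat \<Rightarrow> real) \<Rightarrow> real" where
  "weight t = (\<Sum>n. t n * (1/2) ^ Suc n)"

lemma summable_weight:
  assumes "thread g t" shows "summable (\<lambda>n. t n * (1/2) ^ Suc n)"
proof (rule summable_comparison_test')
  show "summable (\<lambda>n. (\<bar>t 0\<bar> + 1) * (1/2) ^ Suc n)"
    by (intro summable_mult sums_summable[OF power_half_series])
  show "norm (t n * (1/2) ^ Suc n) \<le> (\<bar>t 0\<bar> + 1) * (1/2) ^ Suc n" for n
  proof -
    have "\<bar>t n\<bar> \<le> \<bar>t 0\<bar> + 1" using thread_near[OF assms, of n 0] by linarith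
    then show ?thesis unfolding norm_mult by (intro mult_mono) auto
  qed
qed

lemma weight_plus1:
  assumes "thread g t" shows "weight (\<lambda>n. t n + 1) = weight t + 1"
proof -
  have "(\<lambda>n. t n * (1/2) ^ Suc n + (1/2) ^ Suc n) sums (weight t + 1)"
    unfolding weight_def by (intro sums_add summable_sums summable_weight assms power_half_series)
  then have "(\<lambda>n. (t n + 1) * (1/2) ^ Suc n) sums (weight t + 1)"
    by (simp only: distrib_right mult_1_left)
  then show ?thesis unfolding weight_def[of "\<lambda>n. t n + 1"] by (rule sums_unique[symmetric])
qed

text \<open>Comparable threads allow no cancellation: all terms of the difference of the weights
  have one sign, so each is bounded by the total. Hence the weight is injective and coordinates
  depend on it in a Lipschitz way.\<close>

lemma coordinate_le_weight:
  assumes "thread g s" "thread g t"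
  shows "\<bar>s n - t n\<bar> \<le> 2 ^ Suc n * \<bar>weight s - weight t\<bar>"
proof -
  have *: "(t n - s n) \<le> 2 ^ Suc n * (weight t - weight s)"
    if st: "thread g s" "thread g t" and le: "\<And>n. s n \<le> t n" for s t n
  proof -
    have "(\<lambda>n. t n * (1/2) ^ Suc n - s n * (1/2) ^ Suc n) sums (weight t - weight s)"
      unfolding weight_def by (intro sums_diff summable_sums summable_weight st)
    then have sums: "(\<lambda>n. (t n - s n) * (1/2) ^ Suc n) sums (weight t - weight s)"
      by (simp only: left_diff_distrib)
    have "sum (\<lambda>n. (t n - s n) * (1/2) ^ Suc n) {n} \<le> (\<Sum>n. (t n - s n) * (1/2) ^ Suc n)"
      by (rule sum_le_suminf) (use le sums in \<open>auto simp: sums_iff\<close>)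
    also have "\<dots> = weight t - weight s" using sums by (simp add: sums_iff)
    finally show ?thesis by (simp add: field_simps)
  qed
  from thread_linear[OF assms] show ?thesis
  proof
    assume le: "\<forall>n. s n \<le> t n"
    then have "\<bar>s n - t n\<bar> = t n - s n" by (simp add: abs_minus_commute)
    also have "\<dots> \<le> 2 ^ Suc n * (weight t - weight s)" using *[OF assms] le by blast
    also have "\<dots> \<le> 2 ^ Suc n * \<bar>weight s - weight t\<bar>" by (intro mult_left_mono) auto
    finally show ?thesis .
  next
    assume le: "\<forall>n. t n \<le> s n"
    then have "\<bar>s n - t n\<bar> = s n - t n" by simp
    also have "\<dots> \<le> 2 ^ Suc n * (weight s - weight t)" using *[OF assms(2,1)] le by blast
    also have "\<dots> \<le> 2 ^ Suc n * \<bar>weight s - weight t\<bar>" by (intro mult_left_mono) auto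
    finally show ?thesis .
  qed
qed

text \<open>The mass \<open>(1/2) ^ N\<close> of the tail is placed at coordinate \<open>N\<close>,
  so on threads the value depends on \<open>t N\<close> alone and the weights still add up to
  one.\<close>

definition partial_weight :: "nat \<Rightarrow> (nat \<Rightarrow> real) \<Rightarrow> real" where
  "partial_weight N t = (\<Sum>n<N. t n * (1/2) ^ Suc n) + t N * (1/2) ^ N"

lemma partial_weight_near:
  assumes t: "thread g t"
  shows "\<bar>weight t - partial_weight N t\<bar> \<le> (1/2) ^ N"
proof -
  have geometric: "(\<lambda>n. (1/2) ^ Suc (n + N)) sums ((1/2::real) ^ N)"
    using sums_mult[OF power_half_series, of "(1/2) ^ N"] by (simp add: power_add mult_ac)
  have "(\<lambda>n. t (n + N) * (1/2) ^ Suc (n + N)) sums (weight t - (\<Sum>n<N. t n * (1/2) ^ Suc n))"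
    unfolding weight_def
    using sums_iff_shift[of "\<lambda>n. t n * (1/2) ^ Suc n" N] summable_sums[OF summable_weight[OF t]] by simp
  from sums_diff[OF this sums_mult[OF geometric, of "t N"]]
  have sums: "(\<lambda>n. (t (n + N) - t N) * (1/2) ^ Suc (n + N)) sums (weight t - partial_weight N t)"
    by (simp only: partial_weight_def left_diff_distrib diff_diff_eq)
  have term_le: "norm ((t (n + N) - t N) * (1/2) ^ Suc (n + N)) \<le> (1/2) ^ Suc (n + N)" for n
  proof -
    have "\<bar>t (n + N) - t N\<bar> * (1/2) ^ Suc (n + N) \<le> 1 * (1/2) ^ Suc (n + N)"
      by (intro mult_right_mono thread_near t) auto
    then show ?thesis by (simp add: abs_mult)
  qed
  have "norm (\<Sum>n. (t (n + N) - t N) * (1/2) ^ Suc (n + N)) \<le> (\<Sum>n. (1/2) ^ Suc (n + N))"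
    by (rule norm_suminf_le[OF term_le sums_summable[OF geometric]])
  then show ?thesis using sums geometric by (simp only: sums_iff real_norm_def)
qed

lemma continuous_on_descend: "continuous_on UNIV (descend g n k)"
proof (induction k)
  case (Suc k)
  have "continuous_on UNIV (\<lambda>s. descend g n k (g (n + k) s))"
    by (rule continuous_on_compose2[OF Suc cont]) auto
  then show ?case by simp
qed simp

text \<open>Coordinates below \<open>N\<close> are images of \<open>t N\<close>, so the partial
  weight is a continuous function \<open>?P\<close> of one real number. It fixes the integers, so
  the intermediate value theorem reaches \<open>u\<close>.\<close>

lemma thread_approx:
  obtains t where "thread g t" "partial_weight N t = u"
proof -
  let ?P = "\<lambda>s. (\<Sum>n<N. descend g n (N - n) s * (1/2) ^ Suc n) + s * (1/2) ^ N"
  have P: "?P (t N) = partial_weight N t" if "thread g t" for t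
    unfolding partial_weight_def using descend_thread[OF that, of _ "N - _"]
    by (auto intro!: sum.cong arg_cong2[where f = "(*)"]) (metis le_add_diff_inverse less_imp_le descend_thread[OF that])
  have half: "partial_weight N (\<lambda>n. c) = c" for c
    by (induction N) (auto simp: partial_weight_def algebra_simps)
  have P_int: "?P (of_int k) = of_int k" for k using P[OF thread_int[of k]] half by simp
  have "continuous_on UNIV ?P"
    by (intro continuous_intros continuous_on_descend)
  then have "continuous_on A ?P" for A using continuous_on_subset by blast
  then have "\<exists>s\<ge>of_int \<lfloor>u\<rfloor>. s \<le> of_int (\<lfloor>u\<rfloor> + 1) \<and> ?P s = u"
    by (intro IVT') (use P_int[of "\<lfloor>u\<rfloor>"] P_int[of "\<lfloor>u\<rfloor> + 1"] in linarith)+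
  then obtain s where "?P s = u" by blast
  moreover obtain t where "thread g t" "t N = s" using thread_through[of g N s] surj_step by blast
  ultimately show ?thesis using P[of t] that by simp
qed

text \<open>Threads \<open>T N\<close> with partial weight \<open>u\<close> have weights tending to
  \<open>u\<close>; by \<open>coordinate_le_weight\<close> every coordinate converges, and the
  limits form a thread since each \<open>g n\<close> is continuous.\<close>

lemma weight_surj:
  obtains t where "thread g t" "weight t = u"
proof -
  have "\<forall>N. \<exists>t. thread g t \<and> partial_weight N t = u" using thread_approx by metis
  then obtain T where T: "\<And>N. thread g (T N)" "\<And>N. partial_weight N (T N) = u" by metis
  then have near: "\<bar>weight (T N) - u\<bar> \<le> (1/2) ^ N" for N using partial_weight_near[of "T N" N] by simp
  have half0: "(\<lambda>N. (1/2::real) ^ N) \<longlonglongrightarrow> 0" by (intro LIMSEQ_power_zero) auto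
  have lim: "(\<lambda>N. weight (T N)) \<longlonglongrightarrow> u"
    by (rule LIM_zero_cancel, rule Lim_null_comparison[OF _ half0]) (use near in auto)
  have "Cauchy (\<lambda>N. T N n)" for n
  proof (rule metric_CauchyI)
    fix e :: real assume "e > 0"
    then have "e / 2 ^ Suc n > 0" by simp
    then obtain M where M: "\<forall>i\<ge>M. \<forall>j\<ge>M. dist (weight (T i)) (weight (T j)) < e / 2 ^ Suc n"
      using metric_CauchyD LIMSEQ_imp_Cauchy[OF lim] by blast
    have "dist (T i n) (T j n) < e" if "i \<ge> M" "j \<ge> M" for i j
    proof -
      have "dist (T i n) (T j n) \<le> 2 ^ Suc n * dist (weight (T i)) (weight (T j))"
        unfolding dist_real_def by (rule coordinate_le_weight[OF T(1) T(1)])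
      also have "\<dots> < 2 ^ Suc n * (e / 2 ^ Suc n)" using M that by (intro mult_strict_left_mono) auto
      finally show ?thesis by simp
    qed
    then show "\<exists>M. \<forall>i\<ge>M. \<forall>j\<ge>M. dist (T i n) (T j n) < e" by blast
  qed
  then have "\<forall>n. \<exists>l. (\<lambda>N. T N n) \<longlonglongrightarrow> l" by (simp add: Cauchy_convergent_iff convergent_def)
  then obtain t where t: "\<And>n. (\<lambda>N. T N n) \<longlonglongrightarrow> t n" by metis
  have "thread g t"
    unfolding thread_def
  proof
    fix n
    have "isCont (g n) (t (Suc n))" using cont by (simp add: continuous_on_eq_continuous_at)
    then have "(\<lambda>N. g n (T N (Suc n))) \<longlonglongrightarrow> g n (t (Suc n))" using t isCont_tendsto_compose by blast
    moreover have "g n (T N (Suc n)) = T N n" for N using T(1) by (simp add: thread_def)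
    ultimately have "(\<lambda>N. T N n) \<longlonglongrightarrow> g n (t (Suc n))" by simp
    then show "g n (t (Suc n)) = t n" by (rule LIMSEQ_unique[OF _ t])
  qed
  moreover have "weight t = u"
  proof -
    \<comment> \<open>Coordinatewise convergence alone does not pass through the infinite sum. The
      limit is taken in the finite expression \<open>partial_weight K\<close>, which is within
      \<open>(1/2) ^ K\<close> of the weight for all threads.\<close>
    have bound: "\<bar>weight t - u\<bar> \<le> (1/2) ^ K + (1/2) ^ K" for K
    proof -
      have "(\<lambda>N. partial_weight K (T N)) \<longlonglongrightarrow> partial_weight K t"
        unfolding partial_weight_def by (intro tendsto_intros t)
      then have "(\<lambda>N. \<bar>partial_weight K (T N) - weight (T N)\<bar>) \<longlonglongrightarrow> \<bar>partial_weight K t - u\<bar>"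
        by (intro tendsto_intros lim)
      then have "\<bar>partial_weight K t - u\<bar> \<le> (1/2) ^ K"
        by (rule LIMSEQ_le_const2) (use partial_weight_near[OF T(1)] in \<open>auto simp: abs_minus_commute\<close>)
      with partial_weight_near[OF \<open>thread g t\<close>, of K] show ?thesis by linarith
    qed
    have "\<bar>weight t - u\<bar> \<le> 0 + 0"
      by (rule LIMSEQ_le_const[OF tendsto_add[OF half0 half0]]) (use bound in blast)
    then show ?thesis by simp
  qed
  ultimately show ?thesis by (rule that)
qed

text \<open>\<open>f n u\<close> is coordinate \<open>n\<close> of the unique thread of weight
  \<open>u\<close>; \<open>coordinate_le_weight\<close> gives uniqueness and continuity.\<close>

lemma thread_parametrization:
  obtains f :: "nat \<Rightarrow> real \<Rightarrow> real" where "\<And>n. continuous_on UNIV (f n)" "\<And>u. thread g (\<lambda>n. f n u)"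
    "\<And>n u. f n (u + 1) = f n u + 1" "\<And>t. thread g t \<Longrightarrow> \<exists>u. \<forall>n. t n = f n u"
    "\<And>u v. (\<And>n. f n u = f n v) \<Longrightarrow> u = v"
proof -
  have "\<forall>u. \<exists>t. thread g t \<and> weight t = u" using weight_surj by metis
  then obtain F where F: "\<And>u. thread g (F u)" "\<And>u. weight (F u) = u" by metis
  have unique: "t n = F (weight t) n" if "thread g t" for t n
    using coordinate_le_weight[OF that F(1)[of "weight t"], of n] by (simp add: F)
  show ?thesis
  proof (rule that[of "\<lambda>n u. F u n"])
    show "continuous_on UNIV (\<lambda>u. F u n)" for n
    proof -
      have "dist (F u n) (F v n) \<le> 2 ^ Suc n * dist u v" for u v
        using coordinate_le_weight[OF F(1)[of u] F(1)[of v], of n] by (simp add: F dist_real_def)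
      then have "(2 ^ Suc n)-lipschitz_on UNIV (\<lambda>u. F u n)" by (intro lipschitz_onI) auto
      then show ?thesis by (rule lipschitz_on_continuous_on)
    qed
    show "thread g (\<lambda>n. F u n)" for u using F(1) by simp
    show "F (u + 1) n = F u n + 1" for n u
      using unique[OF thread_plus1[OF F(1)[of u]], of n] by (simp add: weight_plus1[OF F(1)] F(2))
    show "\<exists>u. \<forall>n. t n = F u n" if "thread g t" for t using unique[OF that] by blast
    show "u = v" if "\<And>n. F u n = F v n" for u v using that F(2) by (metis ext)
  qed
qed

end

subsection \<open>The boundary\<close>

context cat0_plane
begin

text \<open>The geodesics from \<open>b\<close> to \<open>c n\<close> converge pointwise: the CAT(0) inequality bounds the squared
  distance between the \<open>n\<close>-th and any later one at time \<open>t\<close> by a multiple of \<open>t\<^sup>2 / n\<close>.\<close>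

lemma asymptotic_ray_from_base:
  assumes c: "geodesic_ray c"
  obtains c' where "geodesic_ray c'" "c' 0 = b" "(c', c) \<in> asymptotic"
proof -
  define D where "D = dist b (c 0)"
  define p where "p = (\<lambda>n::nat. dist b (c n))"
  have D: "D \<ge> 0" by (simp add: D_def)
  have cc: "dist (c s) (c t) = \<bar>s - t\<bar>" if "0 \<le> s" "0 \<le> t" for s t
    using c that by (simp add: geodesic_ray_def)
  have p: "\<bar>p n - n\<bar> \<le> D" for n
    using dist_triangle[of b "c n" "c 0"] dist_triangle[of "c 0" "c n" b] cc[of 0 n]
    by (simp add: p_def D_def dist_commute)
  define X where "X = (\<lambda>t n. geo b (c (real n)) t)"
  \<comment> \<open>The difference of squares below is a product of factors at most
    \<open>2 * D\<close> and \<open>2 * m\<close>, divided by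
    \<open>p n * p m \<ge> n * m / 4\<close>; this makes 16. The lower bound on \<open>n\<close>
    ensures \<open>t \<le> p n\<close> and \<open>n / 2 \<le> p n\<close>.\<close>
  have near: "(dist (X t n) (X t m))\<^sup>2 \<le> 16 * D * t\<^sup>2 / n"
    if t: "0 \<le> t" "t + 2 * D + 1 \<le> n" and nm: "n \<le> m" for t n m
  proof -
    have le: "t \<le> p n" "t \<le> p m" and pos: "p n > 0" "p m > 0"
      and ge: "n / 2 \<le> p n" "m / 2 \<le> p m" and n: "0 < real n" "0 < real m"
      using p[of n] p[of m] that D by linarith+
    have d: "dist (c n) (c m) = real m - n" using cc[of n m] nm by simp
    have ne: "b \<noteq> c n" "b \<noteq> c m" using pos by (auto simp: p_def)
    have "(dist (X t n) (X t m))\<^sup>2 \<le> t\<^sup>2 + t\<^sup>2 - t * t / (p n * p m) * ((p n)\<^sup>2 + (p m)\<^sup>2 - (real m - n)\<^sup>2)"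
      unfolding X_def p_def d[symmetric]
      using cat0_inequality[OF is_geodesic_geo is_geodesic_geo ne, of t t] le t(1) by (simp add: p_def)
    also have "\<dots> = t\<^sup>2 / (p n * p m) * ((real m - n)\<^sup>2 - (p m - p n)\<^sup>2)"
    proof -
      have "K * (x * y) + K * (x * y) - K * (x\<^sup>2 + y\<^sup>2 - e\<^sup>2) = K * (e\<^sup>2 - (y - x)\<^sup>2)" for K x y e :: real
        by (simp add: power2_eq_square algebra_simps)
      from this[of "t\<^sup>2 / (p n * p m)" "p n" "p m" "real m - n"] show ?thesis
        using pos by (simp only: power2_eq_square[of t]) simp
    qed
    also have "\<dots> \<le> t\<^sup>2 / (p n * p m) * (4 * D * m)"
    proof (rule mult_left_mono)
      have tri: "\<bar>p m - p n\<bar> \<le> real m - n"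
        using dist_triangle[of b "c n" "c m"] dist_triangle[of b "c m" "c n"] d
        by (simp add: p_def dist_commute abs_le_iff)
      have "(real m - n)\<^sup>2 - (p m - p n)\<^sup>2 = ((real m - n) - (p m - p n)) * ((real m - n) + (p m - p n))"
        by (simp add: power2_eq_square algebra_simps)
      also have "\<dots> \<le> (2 * D) * (2 * m)"
        using tri p[of n] p[of m] D by (intro mult_mono) linarith+
      finally show "(real m - n)\<^sup>2 - (p m - p n)\<^sup>2 \<le> 4 * D * m" by simp
    qed (use pos in auto)
    also have "\<dots> \<le> t\<^sup>2 / (real n / 2 * (real m / 2)) * (4 * D * m)"
      using ge n D pos by (intro mult_right_mono divide_left_mono mult_mono mult_pos_pos) auto
    also have "\<dots> = 16 * D * t\<^sup>2 / n" using n by (simp add: field_simps)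
    finally show ?thesis .
  qed
  have "\<exists>l. X t \<longlonglongrightarrow> l" if t: "0 \<le> t" for t
  proof -
    define N where "N = nat \<lceil>t + 2 * D + 1\<rceil>"
    have N: "t + 2 * D + 1 \<le> real (n + N)" for n unfolding N_def by linarith
    have "Cauchy (\<lambda>n. X t (n + N))"
    proof (rule metric_CauchyI)
      fix e :: real assume e: "e > 0"
      obtain M :: nat where M: "16 * D * t\<^sup>2 / e\<^sup>2 < M" using reals_Archimedean2 by blast
      have *: "dist (X t (i + N)) (X t (j + N)) < e" if "M \<le> i" "i \<le> j" for i j
      proof -
        have n: "real (i + N) > 0" using N[of i] t D by linarith
        have "16 * D * t\<^sup>2 / e\<^sup>2 < real (i + N)" using M that by linarith
        then have "16 * D * t\<^sup>2 < e\<^sup>2 * real (i + N)" using e by (simp add: field_simps)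
        then have "16 * D * t\<^sup>2 / real (i + N) < e\<^sup>2" using n by (simp add: divide_less_eq)
        with near[OF t N[of i], of "j + N"] that have "(dist (X t (i + N)) (X t (j + N)))\<^sup>2 < e\<^sup>2" by linarith
        then show ?thesis using e by (simp add: power_less_imp_less_base)
      qed
      have "dist (X t (i + N)) (X t (j + N)) < e" if "M \<le> i" "M \<le> j" for i j
        using *[of i j] *[of j i] that by (cases "i \<le> j") (auto simp: dist_commute)
      then show "\<exists>M. \<forall>i\<ge>M. \<forall>j\<ge>M. dist (X t (i + N)) (X t (j + N)) < e" by blast
    qed
    moreover have "X t (n + N) \<in> cball b t" for n
    proof -
      have "t \<le> p (n + N)" using p[of "n + N"] N[of n] D by linarith
      then show ?thesis using t by (simp add: X_def p_def dist_geo)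
    qed
    ultimately obtain l where "(\<lambda>n. X t (n + N)) \<longlonglongrightarrow> l"
      using compact_imp_complete[OF compact_cball_X[of b t]] unfolding complete_def by metis
    then show ?thesis using LIMSEQ_offset by blast
  qed
  then obtain L where L: "\<And>t. 0 \<le> t \<Longrightarrow> X t \<longlonglongrightarrow> L t" by metis
  have ev: "\<forall>\<^sub>F n in sequentially. t \<le> p n" for t
  proof (rule eventually_sequentiallyI)
    fix n assume "nat \<lceil>t + D\<rceil> \<le> n"
    then show "t \<le> p n" using p[of n] by linarith
  qed
  have "geodesic_ray L"
    unfolding geodesic_ray_def
  proof (intro allI impI)
    fix s t :: real assume st: "0 \<le> s" "0 \<le> t"
    have "(\<lambda>n. dist (X s n) (X t n)) \<longlonglongrightarrow> dist (L s) (L t)" using st by (intro tendsto_dist L)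
    moreover have "\<forall>\<^sub>F n in sequentially. dist (X s n) (X t n) = \<bar>s - t\<bar>"
      using ev[of s] ev[of t] by eventually_elim (use st in \<open>simp add: X_def p_def dist_geo_geo\<close>)
    then have "(\<lambda>n. dist (X s n) (X t n)) \<longlonglongrightarrow> \<bar>s - t\<bar>" by (rule tendsto_eventually)
    ultimately show "dist (L s) (L t) = \<bar>s - t\<bar>" by (rule LIMSEQ_unique)
  qed
  moreover have "L 0 = b"
  proof -
    have "X 0 \<longlonglongrightarrow> b" by (simp add: X_def)
    then show ?thesis using L[of 0] LIMSEQ_unique by blast
  qed
  moreover have "dist (L t) (c t) \<le> 2 * D" if t: "0 \<le> t" for t
  proof (rule LIMSEQ_le_const2)
    show "(\<lambda>n. dist (X t n) (c t)) \<longlonglongrightarrow> dist (L t) (c t)" using t by (intro tendsto_intros L)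
    show "\<exists>N. \<forall>n\<ge>N. dist (X t n) (c t) \<le> 2 * D"
    proof (intro exI allI impI)
      fix n assume "nat \<lceil>t + D + 1\<rceil> \<le> n"
      then have n: "t < p n" "t \<le> n" using p[of n] D by linarith+
      then have pos: "p n > 0" using t by linarith
      \<comment> \<open>Seen from \<open>c n\<close>, the points \<open>X t n\<close> and
        \<open>c (n - l * n)\<close> lie at proportion \<open>l\<close> of the geodesics to
        \<open>b\<close> and to \<open>c 0\<close>, whose ends are \<open>D\<close> apart. The
        second \<open>D\<close> pays for moving the parameter \<open>n - l * n\<close> to
        \<open>t\<close>.\<close>
      define l where "l = (p n - t) / p n"
      have l: "0 \<le> l" "l \<le> 1" "l * p n = p n - t" using n t pos by (auto simp: l_def)
      have "is_geodesic (c n) (c 0) (\<lambda>s. c (real n - s))"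
        using is_geodesic_reverse[OF ray_is_geodesic(2)[OF c, of n]] ray_is_geodesic(1)[OF c, of n] by simp
      from geodesic_contraction[OF is_geodesic_reverse[OF is_geodesic_geo[of b "c n"]] this l(1,2)]
      have "dist (X t n) (c (n - l * n)) \<le> l * D"
        using l(3) ray_is_geodesic(1)[OF c, of n] by (simp add: X_def p_def D_def dist_commute)
      also have "\<dots> \<le> D" using l D by (simp add: mult_left_le_one_le)
      finally have 1: "dist (X t n) (c (n - l * n)) \<le> D" .
      have eq: "n - l * n - t = t * (n - p n) / p n" using pos by (simp add: l_def field_simps)
      have "\<bar>n - l * n - t\<bar> = t / p n * \<bar>n - p n\<bar>" unfolding eq using t pos by (simp add: abs_mult)
      also have "\<dots> \<le> 1 * D" using p[of n] n t pos by (intro mult_mono) (auto simp: abs_minus_commute)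
      finally have "\<bar>n - l * n - t\<bar> \<le> D" by simp
      moreover have "0 \<le> n - l * n" using mult_right_mono[OF l(2), of "real n"] by simp
      ultimately have "dist (c (n - l * n)) (c t) \<le> D" using cc t by simp
      with 1 show "dist (X t n) (c t) \<le> 2 * D"
        using dist_triangle[of "X t n" "c t" "c (n - l * n)"] by linarith
    qed
  qed
  ultimately show ?thesis using that[of L] c by (auto simp: asymptotic_def)
qed

section \<open>Rays from the base point as threads of circle parameters\<close>

text \<open>Radii start at 1 because the sphere of radius 0 is a point. Each circle is rotated so
  that one fixed ray crosses it at parameter 0, which makes the normalisation \<open>base\<close>
  attainable.\<close>

lemma sphere_system:
  obtains \<tau> :: "nat \<Rightarrow> real \<Rightarrow> 'a" and g where
    "\<And>n. continuous_on UNIV (\<tau> n)" "\<And>n t. dist b (\<tau> n t) = Suc n"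
    "\<And>n s t. \<tau> n s = \<tau> n t \<longleftrightarrow> s - t \<in> \<int>"
    "\<And>n y. dist b y = Suc n \<Longrightarrow> \<exists>t. \<tau> n t = y"
    "\<And>n t. geo b (\<tau> (Suc n) t) (Suc n) = \<tau> n (g n t)"
    "circle_inverse_system g"
proof -
  have "\<forall>n. \<exists>\<psi> \<nu>. circle_lift (real (Suc n)) \<psi> \<nu>"
    using circle_lift_exists by (metis of_nat_0_less_iff zero_less_Suc)
  then obtain \<Psi> N where lift: "\<And>n. circle_lift (real (Suc n)) (\<Psi> n) (N n)" by metis
  define \<sigma> where "\<sigma> = (\<lambda>n t. \<Psi> n (cis (2 * pi * t)))"
  have pos: "real (Suc n) > 0" for n by simp
  note lift_facts = continuous_on_circle_lift[OF pos lift] dist_circle_lift[OF pos lift]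
    circle_lift_eq_iff[OF pos lift] circle_lift_surj[OF pos lift]
  have \<sigma>: "continuous_on UNIV (\<sigma> n)" "dist b (\<sigma> n t) = Suc n" "\<sigma> n s = \<sigma> n t \<longleftrightarrow> s - t \<in> \<int>" for n s t
    using lift_facts(1-3) by (simp_all add: \<sigma>_def)
  have \<sigma>_surj: "\<exists>t. \<sigma> n t = y" if "dist b y = Suc n" for n y
    using lift_facts(4)[OF that] unfolding \<sigma>_def by metis
  have "\<exists>G. continuous_on UNIV G \<and> (\<forall>t. geo b (\<sigma> (Suc n) t) (Suc n) = \<sigma> n (G t)) \<and> mono G
      \<and> (\<forall>t. G (t + 1) = G t + 1)" for n
  proof -
    have "real (Suc n) \<le> real (Suc (Suc n))" by simp
    from projection_lift[OF pos this lift lift] show ?thesis unfolding \<sigma>_def by metis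
  qed
  then obtain G where G: "\<And>n. continuous_on UNIV (G n)" "\<And>n t. geo b (\<sigma> (Suc n) t) (Suc n) = \<sigma> n (G n t)"
    "\<And>n. mono (G n)" "\<And>n t. G n (t + 1) = G n t + 1" by metis
  have "H 1 \<noteq> b" by (metis h_H h_base zero_neq_one)
  then obtain c where c: "geodesic_ray c" "c 0 = b" using ray_through by blast
  have "\<forall>n. \<exists>a. \<sigma> n a = c (Suc n)" using \<sigma>_surj ray_dist_base[OF c] by simp
  then obtain a where a: "\<And>n. \<sigma> n (a n) = c (Suc n)" by metis
  have c_proj: "geo b (c (Suc (Suc n))) (Suc n) = c (Suc n)" for n
    using geo_ray[OF c(1), of "real (Suc n)" "real (Suc (Suc n))"] c(2) by simp
  have K: "G n (a (Suc n)) - a n \<in> \<int>" for n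
  proof -
    have "\<sigma> n (G n (a (Suc n))) = \<sigma> n (a n)" by (simp only: a G(2)[symmetric] c_proj)
    then show ?thesis by (simp only: \<sigma>(3))
  qed
  define \<tau> where "\<tau> = (\<lambda>n t. \<sigma> n (t + a n))"
  \<comment> \<open>Subtracting \<open>G n (a (Suc n))\<close> rather than \<open>a n\<close> makes
    \<open>g n 0 = 0\<close> exact; by \<open>K\<close> the two differ by an integer, which
    \<open>\<sigma> n\<close> ignores.\<close>
  define g where "g = (\<lambda>n t. G n (t + a (Suc n)) - G n (a (Suc n)))"
  show ?thesis
  proof (rule that[of \<tau> g])
    fix n :: nat and s t :: real and y :: 'a
    show "continuous_on UNIV (\<tau> n)" unfolding \<tau>_def
      by (rule continuous_on_compose2[OF \<sigma>(1)]) (auto intro!: continuous_intros)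
    show "dist b (\<tau> n t) = Suc n" by (simp add: \<tau>_def \<sigma>(2))
    show "\<tau> n s = \<tau> n t \<longleftrightarrow> s - t \<in> \<int>" by (simp add: \<tau>_def \<sigma>(3))
    show "\<exists>t. \<tau> n t = y" if y: "dist b y = Suc n"
    proof -
      obtain t where "\<sigma> n t = y" using \<sigma>_surj y by blast
      then have "\<tau> n (t - a n) = y" by (simp add: \<tau>_def)
      then show ?thesis by blast
    qed
    have "G n (t + a (Suc n)) - (g n t + a n) \<in> \<int>" using K[of n] by (simp add: g_def)
    then have "\<sigma> n (G n (t + a (Suc n))) = \<sigma> n (g n t + a n)" by (simp only: \<sigma>(3))
    then show "geo b (\<tau> (Suc n) t) (Suc n) = \<tau> n (g n t)" by (simp only: \<tau>_def G(2))
    show "circle_inverse_system g"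
    proof
      fix n t
      show "continuous_on UNIV (g n)" unfolding g_def
        by (intro continuous_intros continuous_on_compose2[OF G(1)]) auto
      show "mono (g n)" using G(3)[of n] by (auto simp: g_def mono_def)
      show "g n (t + 1) = g n t + 1" using G(4)[of n "t + a (Suc n)"] by (simp add: g_def add_ac)
      show "g n 0 = 0" by (simp add: g_def)
    qed
  qed
qed

text \<open>A ray from \<open>b\<close> is determined by its points on the spheres of positive
  integer radius; their circle parameters can be chosen to form a thread, unique up to one common
  integer.\<close>

lemma ray_parametrization:
  obtains \<rho> :: "real \<Rightarrow> real \<Rightarrow> 'a" where
    "\<And>u. geodesic_ray (\<rho> u)" "\<And>u. \<rho> u 0 = b"
    "\<And>t. t > 0 \<Longrightarrow> continuous_on UNIV (\<lambda>u. \<rho> u t)"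
    "\<And>u v. (\<forall>t\<ge>0. \<rho> u t = \<rho> v t) \<longleftrightarrow> u - v \<in> \<int>"
    "\<And>c. geodesic_ray c \<Longrightarrow> c 0 = b \<Longrightarrow> \<exists>u. \<forall>t\<ge>0. c t = \<rho> u t"
proof (rule sphere_system)
  fix \<tau> :: "nat \<Rightarrow> real \<Rightarrow> 'a" and g
  assume \<tau>_cont: "\<And>n. continuous_on UNIV (\<tau> n)" and \<tau>_dist: "\<And>n t. dist b (\<tau> n t) = Suc n"
    and \<tau>_eq: "\<And>n s t. \<tau> n s = \<tau> n t \<longleftrightarrow> s - t \<in> \<int>"
    and \<tau>_surj: "\<And>n y. dist b y = Suc n \<Longrightarrow> \<exists>t. \<tau> n t = y"
    and \<tau>_proj: "\<And>n t. geo b (\<tau> (Suc n) t) (Suc n) = \<tau> n (g n t)"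
    and g: "circle_inverse_system g"
  interpret circle_inverse_system g by (rule g)
  show ?thesis
  proof (rule thread_parametrization)
    fix f :: "nat \<Rightarrow> real \<Rightarrow> real"
    assume f_cont: "\<And>n. continuous_on UNIV (f n)" and f_thread: "\<And>u. thread g (\<lambda>n. f n u)"
      and f_period: "\<And>n u. f n (u + 1) = f n u + 1"
      and f_surj: "\<And>t. thread g t \<Longrightarrow> \<exists>u. \<forall>n. t n = f n u"
      and f_inj: "\<And>u v. (\<And>n. f n u = f n v) \<Longrightarrow> u = v"
    have f_int: "f n (u + of_int k) = f n u + of_int k" for n u k
      using lift_add_int[of "f n" 1] f_period by simp
    have "\<exists>c. geodesic_ray c \<and> c 0 = b \<and> (\<forall>n t. 0 \<le> t \<longrightarrow> t \<le> real (Suc n) \<longrightarrow> c t = geo b (\<tau> n (f n u)) t)" for u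
    proof (rule ray_from_chain[of "\<lambda>n. \<tau> n (f n u)"])
      show "geo b (\<tau> (Suc n) (f (Suc n) u)) (dist b (\<tau> n (f n u))) = \<tau> n (f n u)" for n
        using f_thread[of u] by (simp only: \<tau>_dist \<tau>_proj thread_def)
      fix c assume "geodesic_ray c" "c 0 = b"
        "\<And>n t. 0 \<le> t \<Longrightarrow> t \<le> dist b (\<tau> n (f n u)) \<Longrightarrow> c t = geo b (\<tau> n (f n u)) t"
      then show ?thesis by (intro exI[of _ c]) (simp add: \<tau>_dist)
    qed (simp_all add: \<tau>_dist)
    then obtain \<rho> where \<rho>: "\<And>u. geodesic_ray (\<rho> u)" "\<And>u. \<rho> u 0 = b"
      "\<And>u n t. 0 \<le> t \<Longrightarrow> t \<le> real (Suc n) \<Longrightarrow> \<rho> u t = geo b (\<tau> n (f n u)) t" by metis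
    have \<rho>_Suc: "\<rho> u (Suc n) = \<tau> n (f n u)" for u n
      using \<rho>(3)[of "real (Suc n)" n u] geo_end[of b "\<tau> n (f n u)", unfolded \<tau>_dist] by simp
    have \<rho>_eqI: "c t = \<rho> u t" if c: "geodesic_ray c" "c 0 = b" "\<And>n. c (Suc n) = \<tau> n (f n u)" "0 \<le> t" for c u t
    proof -
      obtain n :: nat where n: "t \<le> real (Suc n)" by (metis real_arch_simple le_SucI of_nat_le_iff order_trans)
      then have "c t = geo b (c (real (Suc n))) t" using geo_ray[OF c(1), of t "real (Suc n)"] c by simp
      then show ?thesis using \<rho>(3)[of t n u] n c(3,4) by simp
    qed
    show ?thesis
    proof (rule that[of \<rho>])
      show "geodesic_ray (\<rho> u)" "\<rho> u 0 = b" for u by (fact \<rho>)+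
      show "continuous_on UNIV (\<lambda>u. \<rho> u t)" if t: "t > 0" for t
      proof -
        obtain n :: nat where n: "t \<le> real (Suc n)" by (metis real_arch_simple le_SucI of_nat_le_iff order_trans)
        have "continuous_on UNIV (\<lambda>u. \<tau> n (f n u))"
          by (rule continuous_on_compose2[OF \<tau>_cont f_cont]) simp
        then have "continuous_on UNIV (\<lambda>u. geo b (\<tau> n (f n u)) t)"
          by (rule continuous_on_compose2[OF continuous_on_geo_radius[OF t]]) (use \<tau>_dist n in auto)
        then show ?thesis using \<rho>(3)[of t n] n t by simp
      qed
      show "(\<forall>t\<ge>0. \<rho> u t = \<rho> v t) \<longleftrightarrow> u - v \<in> \<int>" for u v
      proof
        assume eq: "\<forall>t\<ge>0. \<rho> u t = \<rho> v t"
        have "\<tau> n (f n u) = \<tau> n (f n v)" for n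
          unfolding \<rho>_Suc[symmetric] using eq by simp
        then have int: "f n u - f n v \<in> \<int>" for n by (simp only: \<tau>_eq)
        from int[of 0] obtain k where k: "f 0 u - f 0 v = of_int k" by (auto elim: Ints_cases)
        \<comment> \<open>The integers found at different levels agree, since each
          \<open>g n\<close> commutes with integer shifts.\<close>
        have "f n u = f n v + of_int k" for n
        proof (induction n)
          case 0 then show ?case using k by simp
        next
          case (Suc n)
          obtain j where j: "f (Suc n) u - f (Suc n) v = of_int j" using int by (auto elim: Ints_cases)
          then have "f (Suc n) u = f (Suc n) v + of_int j" by simp
          then have "f n u = f n v + of_int j"
            using f_thread[of u] f_thread[of v] add_int[of n "f (Suc n) v" j] unfolding thread_def by metis
          then have "real_of_int j = of_int k" using Suc by simp
          then show ?case using j by simp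
        qed
        then have "u = v + of_int k" by (rule f_inj[OF trans]) (rule f_int[symmetric])
        then show "u - v \<in> \<int>" by simp
      next
        assume "u - v \<in> \<int>"
        then obtain k where "u - v = of_int k" by (auto elim: Ints_cases)
        then have u: "u = v + of_int k" by simp
        have "\<rho> u (Suc n) = \<tau> n (f n v)" for n unfolding \<rho>_Suc \<tau>_eq u f_int by simp
        then show "\<forall>t\<ge>0. \<rho> u t = \<rho> v t" using \<rho>_eqI[OF \<rho>(1,2)] by blast
      qed
      show "\<exists>u. \<forall>t\<ge>0. c t = \<rho> u t" if c: "geodesic_ray c" "c 0 = b" for c
      proof -
        \<comment> \<open>A parameter \<open>s\<close> of the next point projects to the current
          parameter only modulo 1; subtracting the discrepancy from \<open>s\<close> makes the
          sequence a thread.\<close>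
        have "\<exists>t. \<forall>n. \<tau> n (t n) = c (Suc n) \<and> g n (t (Suc n)) = t n"
        proof (rule dependent_nat_choice)
          show "\<exists>x. \<tau> 0 x = c (Suc 0)" using \<tau>_surj[of "c (Suc 0)" 0] ray_dist_base[OF c] by simp
          fix x n assume x: "\<tau> n x = c (Suc n)"
          obtain s where s: "\<tau> (Suc n) s = c (Suc (Suc n))"
            using \<tau>_surj[of "c (Suc (Suc n))" "Suc n"] ray_dist_base[OF c] by auto
          have "\<tau> n (g n s) = c (Suc n)"
            using \<tau>_proj[of n s] s geo_ray[OF c(1), of "real (Suc n)" "real (Suc (Suc n))"] c(2) by simp
          then have "\<tau> n (g n s) = \<tau> n x" using x by simp
          then have "g n s - x \<in> \<int>" by (simp only: \<tau>_eq)
          then obtain k where "g n s - x = of_int k" by (auto elim: Ints_cases)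
          then have "g n (s + of_int (- k)) = x" using add_int[of n s "- k"] by simp
          moreover have "\<tau> (Suc n) (s + of_int (- k)) = c (Suc (Suc n))" unfolding s[symmetric] \<tau>_eq by simp
          ultimately show "\<exists>y. \<tau> (Suc n) y = c (Suc (Suc n)) \<and> g n y = x" by blast
        qed
        then obtain t where t: "\<And>n. \<tau> n (t n) = c (Suc n)" "thread g t" by (auto simp: thread_def)
        then obtain u where "\<And>n. t n = f n u" using f_surj by blast
        then have "c (Suc n) = \<tau> n (f n u)" for n using t(1)[of n] by simp
        then show ?thesis using \<rho>_eqI[OF c] by blast
      qed
    qed
  qed
qed

text \<open>A continuous bijection from a compact space onto a Hausdorff space is a homeomorphism,
  so the inverse need not be examined; continuity is tested on the generators of the cone
  topology.\<close>

lemma cone_topology_homeomorphic_circle: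
  "top_of_set (sphere (0::complex) 1) homeomorphic_space cone_topology b"
proof (rule ray_parametrization)
  fix \<rho> :: "real \<Rightarrow> real \<Rightarrow> 'a"
  assume \<rho>: "\<And>u. geodesic_ray (\<rho> u)" "\<And>u. \<rho> u 0 = b"
    and \<rho>_cont: "\<And>t. t > 0 \<Longrightarrow> continuous_on UNIV (\<lambda>u. \<rho> u t)"
    and \<rho>_eq: "\<And>u v. (\<forall>t\<ge>0. \<rho> u t = \<rho> v t) \<longleftrightarrow> u - v \<in> \<int>"
    and \<rho>_surj: "\<And>c. geodesic_ray c \<Longrightarrow> c 0 = b \<Longrightarrow> \<exists>u. \<forall>t\<ge>0. c t = \<rho> u t"
  define A where "A = (\<lambda>z. Arg2pi z / (2 * pi))"
  define \<Theta> where "\<Theta> = (\<lambda>z. asymptotic `` {\<rho> (A z)})"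
  have self: "(\<rho> u, \<rho> u) \<in> asymptotic" for u
    using \<rho>(1) by (auto simp: asymptotic_def intro!: exI[of _ 0])
  have mem: "\<Theta> z \<in> visual_boundary" for z
    unfolding \<Theta>_def visual_boundary_def using \<rho>(1) by (intro quotientI) simp
  have cont_at: "continuous_on (sphere 0 1) (\<lambda>z. \<rho> (A z) t)" if t: "t > 0" for t
    unfolding A_def
  proof (rule continuous_on_circle_of_loop[where J = "\<lambda>u. \<rho> u t"])
    show "path (\<lambda>u. \<rho> u t)" unfolding path_def using \<rho>_cont[OF t] continuous_on_subset by blast
    have "\<rho> 1 t = \<rho> 0 t" using \<rho>_eq[of 1 0] t by simp
    then show "pathfinish (\<lambda>u. \<rho> u t) = pathstart (\<lambda>u. \<rho> u t)" by (simp add: pathfinish_def pathstart_def)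
  qed
  \<comment> \<open>By \<open>asymptotic_rays_eq\<close> the rays from \<open>b\<close> in the class
    \<open>\<Theta> z\<close> agree at nonnegative times, so membership is a metric condition on
    \<open>\<rho> (A z) R\<close>.\<close>
  have in_nbhd: "\<Theta> z \<in> cone_nbhd c R \<epsilon> \<longleftrightarrow> dist (\<rho> (A z) R) (c R) < \<epsilon>"
    if c: "c 0 = b" and R: "R > 0" for z c R \<epsilon>
  proof
    assume "\<Theta> z \<in> cone_nbhd c R \<epsilon>"
    then obtain c' where c': "(\<rho> (A z), c') \<in> asymptotic" "c' 0 = b" "dist (c' R) (c R) < \<epsilon>"
      using c by (auto simp: cone_nbhd_def \<Theta>_def)
    then show "dist (\<rho> (A z) R) (c R) < \<epsilon>" using asymptotic_rays_eq[OF c'(1), of R] \<rho>(2) R by simp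
  next
    assume "dist (\<rho> (A z) R) (c R) < \<epsilon>"
    then show "\<Theta> z \<in> cone_nbhd c R \<epsilon>"
      using mem[of z] self \<rho>(2) c by (auto simp: cone_nbhd_def \<Theta>_def)
  qed
  have "continuous_map (top_of_set (sphere 0 1)) (cone_topology b) \<Theta>"
    unfolding cone_topology_def
  proof (rule continuous_on_generated_topo)
    fix U assume "U \<in> insert visual_boundary {cone_nbhd c R \<epsilon> |c R \<epsilon>. geodesic_ray c \<and> c 0 = b \<and> R > 0 \<and> \<epsilon> > 0}"
    then consider "U = visual_boundary" | c R \<epsilon> where "U = cone_nbhd c R \<epsilon>" "c 0 = b" "R > 0" by blast
    then show "openin (top_of_set (sphere 0 1)) (\<Theta> -` U \<inter> topspace (top_of_set (sphere 0 1)))"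
    proof cases
      case 1
      then have "\<Theta> -` U \<inter> topspace (top_of_set (sphere 0 1)) = sphere 0 1" using mem by auto
      then show ?thesis by (metis openin_topspace topspace_euclidean_subtopology)
    next
      case 2
      then have "\<Theta> -` U \<inter> topspace (top_of_set (sphere 0 1)) =
          sphere 0 1 \<inter> (\<lambda>z. \<rho> (A z) R) -` ball (c R) \<epsilon>"
        using in_nbhd by (auto simp: dist_commute)
      then show ?thesis using continuous_openin_preimage_gen[OF cont_at[OF 2(3)] open_ball] by simp
    qed
  next
    show "\<Theta> ` topspace (top_of_set (sphere 0 1)) \<subseteq>
      \<Union> (insert visual_boundary {cone_nbhd c R \<epsilon> |c R \<epsilon>. geodesic_ray c \<and> c 0 = b \<and> R > 0 \<and> \<epsilon> > 0})"
      using mem by auto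
  qed
  moreover have "compact_space (top_of_set (sphere (0::complex) 1))"
    by (intro compact_space_subtopology) (simp add: compactin_euclidean_iff)
  moreover have surj: "\<Theta> ` topspace (top_of_set (sphere 0 1)) = topspace (cone_topology b)"
  proof -
    have "\<eta> \<in> \<Theta> ` sphere 0 1" if \<eta>: "\<eta> \<in> visual_boundary" for \<eta>
    proof -
      obtain c where c: "geodesic_ray c" "\<eta> = asymptotic `` {c}"
        using \<eta> by (auto simp: visual_boundary_def elim!: quotientE)
      obtain c' where c': "geodesic_ray c'" "c' 0 = b" "(c', c) \<in> asymptotic"
        using asymptotic_ray_from_base[OF c(1)] by blast
      obtain u where u: "\<And>t. t \<ge> 0 \<Longrightarrow> c' t = \<rho> u t" using \<rho>_surj[OF c'(1,2)] by blast
      define z where "z = cis (2 * pi * u)"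
      have z: "z \<in> sphere 0 1" by (simp add: z_def)
      have "z = cis (2 * pi * A z)"
        using Arg2pi_eq[of z] z by (simp add: A_def cis_conv_exp)
      then have "u - A z \<in> \<int>" by (simp add: z_def flip: cis_eq_iff_Ints)
      then have "\<rho> (A z) t = c' t" if "t \<ge> 0" for t using \<rho>_eq[of u "A z"] u that by simp
      then have "(\<rho> (A z), c') \<in> asymptotic"
        using \<rho>(1) c'(1) by (auto simp: asymptotic_def intro!: exI[of _ 0])
      then have "(\<rho> (A z), c) \<in> asymptotic" using c'(3) equiv_asymptotic by (meson equivE transE)
      then have "\<Theta> z = \<eta>" unfolding \<Theta>_def c(2) using equiv_asymptotic equiv_class_eq by metis
      then show ?thesis using z by blast
    qed
    then show ?thesis using mem by (auto simp: topspace_cone_topology)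
  qed
  moreover have "inj_on \<Theta> (topspace (top_of_set (sphere 0 1)))"
  proof (rule inj_onI)
    fix z w assume zw: "z \<in> topspace (top_of_set (sphere 0 1))" "w \<in> topspace (top_of_set (sphere 0 1))" "\<Theta> z = \<Theta> w"
    then have "(\<rho> (A z), \<rho> (A w)) \<in> asymptotic" using self by (auto simp: \<Theta>_def)
    then have "\<forall>t\<ge>0. \<rho> (A z) t = \<rho> (A w) t" using asymptotic_rays_eq \<rho>(2) by metis
    then have "A z - A w \<in> \<int>" by (simp only: \<rho>_eq)
    then obtain k where "A z - A w = of_int k" by (auto elim: Ints_cases)
    moreover have "A z \<in> {0..<1}" "A w \<in> {0..<1}" unfolding A_def by (rule Arg2pi_range)+
    ultimately have "real_of_int k < 1" "- 1 < real_of_int k" "A z - A w = of_int k" by auto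
    then have "k = 0" by linarith
    then have "A z = A w" using \<open>A z - A w = of_int k\<close> by simp
    then have "Arg2pi z = Arg2pi w" by (simp add: A_def)
    then show "z = w" using zw(1,2) Arg2pi_eq[of z] Arg2pi_eq[of w] by simp
  qed
  moreover have "Hausdorff_space (cone_topology b)"
    unfolding Hausdorff_space_def
  proof (intro allI impI)
    fix \<xi> \<eta> assume "\<xi> \<in> topspace (cone_topology b) \<and> \<eta> \<in> topspace (cone_topology b) \<and> \<xi> \<noteq> \<eta>"
    then obtain z w where zw: "\<xi> = \<Theta> z" "\<eta> = \<Theta> w" "\<Theta> z \<noteq> \<Theta> w" by (auto simp flip: surj)
    have "\<exists>R>0. \<rho> (A z) R \<noteq> \<rho> (A w) R"
    proof (rule ccontr)
      assume *: "\<not> ?thesis"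
      have "\<rho> (A z) t = \<rho> (A w) t" if "t \<ge> 0" for t
        using * \<rho>(2) that by (cases "t = 0") auto
      then have "(\<rho> (A z), \<rho> (A w)) \<in> asymptotic"
        using \<rho>(1) by (auto simp: asymptotic_def intro!: exI[of _ 0])
      then have "\<Theta> z = \<Theta> w" unfolding \<Theta>_def using equiv_asymptotic equiv_class_eq by metis
      then show False using zw by simp
    qed
    then obtain R where R: "R > 0" "\<rho> (A z) R \<noteq> \<rho> (A w) R" by blast
    define \<epsilon> where "\<epsilon> = dist (\<rho> (A z) R) (\<rho> (A w) R) / 2"
    have \<epsilon>: "\<epsilon> > 0" using R by (simp add: \<epsilon>_def)
    let ?U = "cone_nbhd (\<rho> (A z)) R \<epsilon>" and ?V = "cone_nbhd (\<rho> (A w)) R \<epsilon>"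
    have nbhd: "\<Theta> y \<in> cone_nbhd (\<rho> u) R \<epsilon> \<longleftrightarrow> dist (\<rho> (A y) R) (\<rho> u R) < \<epsilon>" for y u
      by (rule in_nbhd) (use \<rho> R in auto)
    have "openin (cone_topology b) (cone_nbhd (\<rho> u) R \<epsilon>)" for u
      unfolding cone_topology_def using \<rho> R \<epsilon> by (intro topology_generated_by_Basis) blast
    moreover have "\<xi> \<in> ?U" "\<eta> \<in> ?V" using \<epsilon> zw by (simp_all add: nbhd)
    moreover have "disjnt ?U ?V"
    proof -
      have False if x: "x \<in> ?U" "x \<in> ?V" for x
      proof -
        have "x \<in> topspace (cone_topology b)" using x by (simp add: topspace_cone_topology cone_nbhd_def)
        then obtain y where y: "x = \<Theta> y" by (auto simp flip: surj)
        have "dist (\<rho> (A y) R) (\<rho> (A z) R) < \<epsilon>" "dist (\<rho> (A y) R) (\<rho> (A w) R) < \<epsilon>"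
          using x unfolding y by (simp_all add: nbhd)
        then show False unfolding \<epsilon>_def
          using dist_triangle3[of "\<rho> (A z) R" "\<rho> (A w) R" "\<rho> (A y) R"] by linarith
      qed
      then show ?thesis by (auto simp: disjnt_def)
    qed
    ultimately show "\<exists>U V. openin (cone_topology b) U \<and> openin (cone_topology b) V \<and> \<xi> \<in> U \<and> \<eta> \<in> V \<and> disjnt U V"
      by blast
  qed
  ultimately have "homeomorphic_map (top_of_set (sphere 0 1)) (cone_topology b) \<Theta>"
    by (intro continuous_imp_homeomorphic_map) auto
  then show ?thesis by (rule homeomorphic_map_imp_homeomorphic_space)
qed

end

section \<open>Transfer from the complex plane to \<open>real^2\<close>\<close>

lemma homeomorphic_imp_homeomorphic_space:
  assumes "S homeomorphic T"
  shows "top_of_set S homeomorphic_space top_of_set T"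
proof -
  obtain f g where "homeomorphism S T f g" using assms by (auto simp: homeomorphic_def)
  then have "homeomorphic_maps (top_of_set S) (top_of_set T) f g"
    by (auto simp: homeomorphic_maps_def homeomorphism_def)
  then show ?thesis by (auto simp: homeomorphic_space_def)
qed

theorem proposition1p1:
  assumes "proper_space TYPE('a::metric_space)"
    and "CAT0_space TYPE('a)"
    and "(UNIV :: 'a set) homeomorphic (UNIV :: (real^2) set)"
  shows "(\<forall>x::'a. \<forall>r>0. sphere x r homeomorphic sphere (0::real^2) 1) \<and>
         (\<forall>b::'a. cone_topology b homeomorphic_space top_of_set (sphere (0::real^2) 1))"
proof -
  have "(UNIV :: (real^2) set) homeomorphic (UNIV :: complex set)"
    by (intro homeomorphic_subspaces) auto
  then have "(UNIV :: 'a set) homeomorphic (UNIV :: complex set)"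
    by (rule homeomorphic_trans[OF assms(3)])
  then obtain h :: "'a \<Rightarrow> complex" and H where hH: "homeomorphism UNIV UNIV h H"
    by (auto simp: homeomorphic_def)
  \<comment> \<open>All centres are treated at once by translating the given homeomorphism so that
    it sends the current \<open>b\<close> to 0.\<close>
  have plane: "cat0_plane b (\<lambda>x. h x - h b) (\<lambda>z. H (z + h b))" for b :: 'a
  proof
    have "continuous_on UNIV (\<lambda>x. h x - h b)"
      using hH by (intro continuous_intros) (simp add: homeomorphism_def)
    moreover have "continuous_on UNIV (\<lambda>z. H (z + h b))"
      using hH unfolding homeomorphism_def
      by (intro continuous_on_compose2[of UNIV H UNIV "\<lambda>z. z + h b"] continuous_intros) auto
    ultimately show "homeomorphism UNIV UNIV (\<lambda>x. h x - h b) (\<lambda>z. H (z + h b))"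
      using hH by (intro homeomorphismI) (auto simp: homeomorphism_def)
  qed (use assms in auto)
  have circles: "sphere (0::complex) 1 homeomorphic sphere (0::real^2) 1"
    by (rule homeomorphic_spheres_gen) auto
  show ?thesis
  proof (intro conjI allI impI)
    fix x :: 'a and r :: real assume r: "r > 0"
    interpret cat0_plane x "\<lambda>y. h y - h x" "\<lambda>z. H (z + h x)" by (rule plane)
    obtain \<psi> \<nu> where "circle_lift r \<psi> \<nu>" using circle_lift_exists[OF r] .
    then have "sphere (0::complex) 1 homeomorphic sphere x r"
      by (auto simp: circle_lift_def homeomorphic_def)
    then show "sphere x r homeomorphic sphere (0::real^2) 1"
      using circles homeomorphic_sym homeomorphic_trans by blast
  next
    fix b :: 'a
    interpret cat0_plane b "\<lambda>y. h y - h b" "\<lambda>z. H (z + h b)" by (rule plane)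
    show "cone_topology b homeomorphic_space top_of_set (sphere (0::real^2) 1)"
      using cone_topology_homeomorphic_circle homeomorphic_imp_homeomorphic_space[OF circles]
        homeomorphic_space_sym homeomorphic_space_trans by blast
  qed
qed

end
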